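(* Let $I=[0,T]$ with $T>0$ and let $F\colon I\times\mathbb{R}^N\multimap\mathbb{R}^N$ be a Carathéodory map. Suppose there exists a potential $V\colon\mathbb{R}^N\to\mathbb{R}$ which is even ($V(-x)=V(x)$ for all $x$), coercive, and a weakly positively guiding potential for $F$. Then the antiperiodic problem $$\dot{x}(t)\in F(t,x(t))\ \text{ for a.e. } t\in I,\qquad x(0)=-x(T)$$ possesses at least one solution $x\in AC(I,\mathbb{R}^N)$.
   Context: $AC(I,\mathbb{R}^N)$ is the space of absolutely continuous functions $I\to\mathbb{R}^N$; solutions are absolutely continuous functions. $|\cdot|$ and $\langle\cdot,\cdot\rangle$ are the Euclidean norm and inner product in $\mathbb{R}^N$. A multivalued map $F\colon X\multimap Z$ assigns to each $x\in X$ a nonempty subset $F(x)\subset Z$. Carathéodory map: $F\colon I\times\mathbb{R}^N\multimap\mathbb{R}^N$ with nonempty convex compact values such that ($F_1$) for every fixed $x\in\mathbb{R}^N$ the multimap $t\mapsto F(t,x)$ is measurable, i.e. $\{t\in I\colon F(t,x)\subset A\}$ is Lebesgue measurable for every closed $A\subset\mathbb{R}^N$; ($F_2$) for a.e. $t\in I$ the multimap $x\mapsto F(t,x)$ is upper semicontinuous; ($F_3$) there is $\mu\in L^1(I,\mathbb{R})$ with $\sup\{|y|\colon y\in F(t,x)\}\leqslant\mu(t)(1+|x|)$ for every $(t,x)\in I\times\mathbb{R}^N$. $V$ is coercive if $V(x)\to+\infty$ as $|x|\to+\infty$. Weakly positively guiding potential for $F$: $V\in C^1(\mathbb{R}^N,\mathbb{R})$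 which is nonsingular, i.e. there is $R>0$ with $\nabla V(x)\neq 0$ for all $|x|\geqslant R$, and such that there is $R>0$ such that for all $|x|\geqslant R$ and all $t\in I$ there exists $y\in F(t,x)$ with $\langle\nabla V(x),y\rangle\geqslant 0$. *)

theory Defs
  imports "HOL-Analysis.Analysis"
begin

definition usc_multimap :: "('a::topological_space \<Rightarrow> 'b::topological_space set) \<Rightarrow> bool" where
  "usc_multimap G \<longleftrightarrow> (\<forall>U. open U \<longrightarrow> open {x. G x \<subseteq> U})"

definition caratheodory_map ::
  "real set \<Rightarrow> (real \<Rightarrow> real^'n \<Rightarrow> (real^'n) set) \<Rightarrow> bool" where
  "caratheodory_map I F \<longleftrightarrow>
     (\<forall>t\<in>I. \<forall>x. F t x \<noteq> {} \<and> convex (F t x) \<and> compact (F t x)) \<and>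
     (\<forall>x A. closed A \<longrightarrow> {t \<in> I. F t x \<subseteq> A} \<in> sets lebesgue) \<and>
     (AE t in lebesgue_on I. usc_multimap (F t)) \<and>
     (\<exists>\<mu>::real \<Rightarrow> real. integrable (lebesgue_on I) \<mu> \<and>
        (\<forall>t\<in>I. \<forall>x. (SUP y\<in>F t x. norm y) \<le> \<mu> t * (1 + norm x)))"

text \<open>The gradient is only meaningful at points of differentiability.\<close>

definition gradient :: "(real^'n \<Rightarrow> real) \<Rightarrow> real^'n \<Rightarrow> real^'n" where
  "gradient V x = (THE D. GDERIV V x :> D)"

lemma GDERIV_gradient:
  fixes V :: "real^'n \<Rightarrow> real"
  assumes "V differentiable (at x)"
  shows "GDERIV V x :> gradient V x"
proof -
  obtain f' where f': "(V has_derivative f') (at x)"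
    using assms unfolding differentiable_def by blast
  define D where "D = adjoint f' 1"
  have "f' = (\<lambda>h. h \<bullet> D)"
  proof
    fix h
    show "f' h = h \<bullet> D"
      using adjoint_works[OF has_derivative_linear[OF f'], of h 1]
      by (simp add: D_def)
  qed
  then have D: "GDERIV V x :> D"
    using f' by (simp add: gderiv_def)
  have "E = D" if E: "GDERIV V x :> E" for E
  proof -
    have "(\<lambda>h. h \<bullet> E) = (\<lambda>h. h \<bullet> D)"
      by (rule has_derivative_unique[OF E[unfolded gderiv_def] D[unfolded gderiv_def]])
    then have "\<forall>h. h \<bullet> E = h \<bullet> D" by (simp add: fun_eq_iff)
    then show ?thesis by (simp only: vector_eq_ldot)
  qed
  with D show ?thesis unfolding gradient_def by (rule theI)
qed

definition C1_potential :: "(real^'n \<Rightarrow> real) \<Rightarrow> bool" where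
  "C1_potential V \<longleftrightarrow>
     (\<forall>x. V differentiable (at x)) \<and> continuous_on UNIV (gradient V)"

definition nonsingular_potential :: "(real^'n \<Rightarrow> real) \<Rightarrow> bool" where
  "nonsingular_potential V \<longleftrightarrow> (\<exists>R>0. \<forall>x. norm x \<ge> R \<longrightarrow> gradient V x \<noteq> 0)"

definition weakly_positively_guiding ::
  "real set \<Rightarrow> (real \<Rightarrow> real^'n \<Rightarrow> (real^'n) set) \<Rightarrow> (real^'n \<Rightarrow> real) \<Rightarrow> bool" where
  "weakly_positively_guiding I F V \<longleftrightarrow>
     C1_potential V \<and> nonsingular_potential V \<and>
     (\<exists>R>0. \<forall>x. norm x \<ge> R \<longrightarrow> (\<forall>t\<in>I. \<exists>y\<in>F t x. gradient V x \<bullet> y \<ge> 0))"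

definition coercive :: "('a::real_normed_vector \<Rightarrow> real) \<Rightarrow> bool" where
  "coercive V \<longleftrightarrow> filterlim V at_top at_infinity"

text \<open>Absolute continuity of functions, as opposed to the library's
  \<^const>\<open>absolutely_continuous\<close>, which relates measures.\<close>

definition absolutely_continuous_fun ::
  "real \<Rightarrow> real \<Rightarrow> (real \<Rightarrow> 'a::real_normed_vector) \<Rightarrow> bool" where
  "absolutely_continuous_fun a b f \<longleftrightarrow>
     (\<forall>\<epsilon>>0. \<exists>\<delta>>0. \<forall>n::nat. \<forall>l u :: nat \<Rightarrow> real.
        (\<forall>i<n. a \<le> l i \<and> l i < u i \<and> u i \<le> b) \<longrightarrow>
        disjoint_family_on (\<lambda>i. {l i<..<u i}) {..<n} \<longrightarrow>
        (\<Sum>i<n. u i - l i) < \<delta> \<longrightarrow>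
        (\<Sum>i<n. norm (f (u i) - f (l i))) < \<epsilon>)"

end

theory Submission
  imports Defs "HOL-Complex_Analysis.Great_Picard"
begin

text \<open>
  Since V is even, large sublevel sets of V are symmetric, and since the gradient does not vanish
  near their boundary they have the fixed point property: finitely many gradient steps push a large
  ball into a slightly larger sublevel set and fix the sublevel set itself, so Brouwer applies.
  Solving the inclusion backwards in time, V decreases along suitable approximate solutions: F is
  replaced by a partition-of-unity interpolation of finitely many guided measurable selections,
  perturbed by a small multiple of the gradient of V, which makes the guiding inequality strict.
  Hence the map sending an end value to minus the initial value preserves a sublevel set, and its
  fixed point is an antiperiodic approximate solution. Euler polygons are used instead of solutions
  of an ODE, so that this map is continuous without any Lipschitz assumption.

  In the limit, the trajectories converge uniformly by Arzela-Ascoli. In place of weak compactness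
  of the velocities one takes convex combinations that are Cauchy in the mean and hence converge
  almost everywhere along a subsequence; upper semicontinuity and convexity put the limit into F.
\<close>

subsection \<open>Lebesgue differentiation on the line\<close>

text \<open>Guidance is available for only one \<open>y\<close> in each \<open>F t x\<close>, so a
  velocity field has to be built from selections, and a selection guided at \<open>d\<close> is
  guided at nearby points only up to an error proportional to \<open>1 + \<mu> t\<close>. The added
  multiple of the gradient carries the same factor, so it absorbs the error for every
  \<open>t\<close> at once although \<open>\<mu>\<close> is merely integrable. The same weight, as
  \<open>w = C * (1 + \<mu>)\<close>, measures the Euler steps and normalises the velocities in the
  limit; \<open>C\<close> is independent of the accuracy, so one \<open>w\<close> serves all
  approximations. Four levels of \<open>V\<close> organise the estimates. Above \<open>c - 1\<close>
  the gradient is nonzero and guidance holds; between \<open>c - 1/2\<close> and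
  \<open>c + 1\<close> the approximate field is strictly guided; \<open>c\<close> is the level
  preserved by the antiperiodic map; below \<open>c + 1\<close> the field is controlled. The gaps
  leave room for moving to a nearby point and for a single Euler step, which raise \<open>V\<close>
  by at most 1/4. Strictness pays for the slack in the fixed point theorem, where a slightly larger
  sublevel set must be mapped into the original one.\<close>

lemma integral_absolutely_continuous:
  fixes h :: "'a \<Rightarrow> real"
  assumes h: "integrable M h" and nonneg: "\<And>x. 0 \<le> h x" and "\<epsilon> > 0"
  obtains \<delta> where "\<delta> > 0"
    "\<And>A. A \<in> sets M \<Longrightarrow> emeasure M A < ennreal \<delta> \<Longrightarrow> (LINT x:A|M. h x) < \<epsilon>"
proof -
  have hm [measurable]: "h \<in> borel_measurable M" using h by auto
  \<comment> \<open>Truncation at height \<open>n\<close>: the part of \<open>h\<close> above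
    \<open>n\<close> has small integral over the whole space, and the part below contributes at most
    \<open>n\<close> times the measure of the set.\<close>
  have "(\<lambda>n. LINT x|M. h x - min (h x) (real n)) \<longlonglongrightarrow> (LINT x|M. 0)"
  proof (rule integral_dominated_convergence[where w = h])
    show "AE x in M. (\<lambda>n. h x - min (h x) (real n)) \<longlonglongrightarrow> 0"
    proof (intro always_eventually allI)
      fix x
      obtain N :: nat where N: "h x \<le> real N" using real_arch_simple by blast
      have "\<forall>\<^sub>F n in sequentially. h x - min (h x) (real n) = 0"
        unfolding eventually_sequentially using N by (intro exI[of _ N]) (auto simp: min_def)
      then show "(\<lambda>n. h x - min (h x) (real n)) \<longlonglongrightarrow> 0" by (rule tendsto_eventually)
    qed
    show "AE x in M. norm (h x - min (h x) (real n)) \<le> h x" for n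
      using nonneg by (auto intro!: always_eventually simp: min_def)
  qed (use h in auto)
  then have "(\<lambda>n. LINT x|M. h x - min (h x) (real n)) \<longlonglongrightarrow> 0" by simp
  then have "\<forall>\<^sub>F n in sequentially. (LINT x|M. h x - min (h x) (real n)) < \<epsilon> / 2"
    using \<open>\<epsilon> > 0\<close> by (intro order_tendstoD) auto
  then obtain n where n: "(LINT x|M. h x - min (h x) (real n)) < \<epsilon> / 2"
    by (auto simp: eventually_sequentially)
  define \<delta> where "\<delta> = \<epsilon> / (2 * (real n + 1))"
  show ?thesis
  proof
    show "\<delta> > 0" using \<open>\<epsilon> > 0\<close> by (simp add: \<delta>_def)
    fix A assume A [measurable]: "A \<in> sets M" and small: "emeasure M A < ennreal \<delta>"
    have fin: "emeasure M A < \<infinity>" using small by (metis ennreal_less_top infinity_ennreal_def order_less_trans)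
    have mA: "measure M A \<le> \<delta>" using small \<open>\<delta> > 0\<close> fin
      by (metis Sigma_Algebra.measure_def enn2real_mono ennreal_less_top enn2real_ennreal less_imp_le)
    have im: "integrable M (\<lambda>x. min (h x) (real n))"
      by (rule Bochner_Integration.integrable_bound[OF h])
        (use nonneg in \<open>auto intro!: always_eventually simp: min_def abs_if\<close>)
    have id: "integrable M (\<lambda>x. h x - min (h x) (real n))" using h im by auto
    have iA: "integrable M (\<lambda>x. indicator A x * real n)" using fin by auto
    have "(LINT x:A|M. h x) \<le> (LINT x|M. (h x - min (h x) (real n)) + indicator A x * real n)"
      unfolding set_lebesgue_integral_def
    proof (rule integral_mono)
      show "integrable M (\<lambda>x. indicat_real A x *\<^sub>R h x)"
        using h A by (intro integrable_mult_indicator) auto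
    qed (use id iA nonneg in \<open>auto split: split_indicator simp: min_def\<close>)
    also have "\<dots> = (LINT x|M. h x - min (h x) (real n)) + measure M A * real n"
      using id iA by (simp add: fin)
    also have "\<dots> < \<epsilon> / 2 + \<delta> * (real n + 1)"
      using n mult_mono[OF mA, of "real n" "real n + 1"] \<open>\<delta> > 0\<close> by auto
    also have "\<dots> = \<epsilon>" by (simp add: \<delta>_def field_simps)
    finally show "(LINT x:A|M. h x) < \<epsilon>" .
  qed
qed

text \<open>
  By the Vitali covering theorem E is covered, up to a null set, by disjoint intervals of large
  average inside an open superset of the set where h is nonpositive; this superset exceeds that set
  so little that the integral of h over the intervals is small.
\<close>

lemma negligible_large_averages:
  fixes h :: "real \<Rightarrow> real"
  assumes h: "integrable lebesgue h" and "r > 0" and E: "\<And>x. x \<in> E \<Longrightarrow> h x \<le> 0"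
    and avg: "\<And>x \<delta>. x \<in> E \<Longrightarrow> \<delta> > 0 \<Longrightarrow>
      \<exists>c \<rho>. 0 < \<rho> \<and> \<rho> < \<delta> \<and> x \<in> cball c \<rho> \<and> (LINT y:cball c \<rho>|lebesgue. h y) > r * (2 * \<rho>)"
  shows "negligible E"
proof (rule negligible_outer_le[THEN iffD2], intro allI impI)
  fix \<epsilon> :: real assume "\<epsilon> > 0"
  have hm [measurable]: "h \<in> borel_measurable lebesgue" using h by auto
  define A where "A = {x. h x \<le> 0}"
  have A: "A \<in> sets lebesgue" unfolding A_def using measurable_sets[OF hm, of "{..0}"] by (simp add: vimage_def)
  obtain \<delta> where "\<delta> > 0" and \<delta>: "\<And>A. A \<in> sets lebesgue \<Longrightarrow> emeasure lebesgue A < ennreal \<delta>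
      \<Longrightarrow> (LINT x:A|lebesgue. \<bar>h x\<bar>) < \<epsilon> * r"
    using integral_absolutely_continuous[of lebesgue "\<lambda>x. \<bar>h x\<bar>" "\<epsilon> * r"] h \<open>\<epsilon> > 0\<close> \<open>r > 0\<close> by auto
  obtain U where U: "open U" "A \<subseteq> U" "U - A \<in> lmeasurable" "emeasure lebesgue (U - A) < ennreal \<delta>"
    using sets_lebesgue_outer_open[OF A \<open>\<delta> > 0\<close>] by blast
  define K where "K = {(c, \<rho>). 0 < \<rho> \<and> cball c \<rho> \<subseteq> U \<and> (LINT y:cball c \<rho>|lebesgue. h y) > r * (2 * \<rho>)}"
  obtain C where C: "countable C" "C \<subseteq> K"
     "pairwise (\<lambda>i j. disjnt (cball (fst i) (snd i)) (cball (fst j) (snd j))) C"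
     "negligible (E - (\<Union>i \<in> C. cball (fst i) (snd i)))"
  proof (rule Vitali_covering_theorem_cballs[of K snd E fst])
    show "0 < snd i" if "i \<in> K" for i using that by (auto simp: K_def)
    fix x and d :: real assume x: "x \<in> E" "0 < d"
    then have "x \<in> U" using E U(2) by (auto simp: A_def)
    then obtain e where e: "e > 0" "ball x e \<subseteq> U" using U(1) open_contains_ball by blast
    obtain c \<rho> where c: "0 < \<rho>" "\<rho> < min d (e / 2)" "x \<in> cball c \<rho>"
      "(LINT y:cball c \<rho>|lebesgue. h y) > r * (2 * \<rho>)"
      using avg[OF x(1), of "min d (e / 2)"] x e by auto
    have "cball c \<rho> \<subseteq> ball x e"
    proof
      fix y assume "y \<in> cball c \<rho>"
      then show "y \<in> ball x e" using c dist_triangle[of x y c] by (auto simp: dist_commute)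
    qed
    then show "\<exists>i. i \<in> K \<and> x \<in> cball (fst i) (snd i) \<and> snd i < d"
      using c e by (intro exI[of _ "(c, \<rho>)"]) (auto simp: K_def)
  qed auto
  have bound: "measure lebesgue (\<Union>i\<in>D. cball (fst i) (snd i)) \<le> \<epsilon>"
    if "D \<subseteq> C" "finite D" for D
  proof -
    let ?B = "\<lambda>i. cball (fst i) (snd i :: real)"
    have si: "set_integrable lebesgue S h" if "S \<in> sets lebesgue" for S
      using h that unfolding set_integrable_def by (intro integrable_mult_indicator) auto
    have disj: "disjoint_family_on ?B D"
      using C(3) that unfolding disjoint_family_on_def pairwise_def disjnt_def by blast
    have "r * measure lebesgue (\<Union>i\<in>D. ?B i) \<le> r * (\<Sum>i\<in>D. measure lebesgue (?B i))"
      using \<open>r > 0\<close> that by (intro mult_left_mono measure_UNION_le) auto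
    also have "\<dots> = (\<Sum>i\<in>D. r * (2 * snd i))"
      unfolding sum_distrib_left
    proof (rule sum.cong)
      fix i assume "i \<in> D"
      then have "snd i > 0" using that C(2) by (auto simp: K_def)
      then show "r * measure lebesgue (?B i) = r * (2 * snd i)"
        by (simp add: cball_eq_atLeastAtMost)
    qed auto
    also have "\<dots> \<le> (\<Sum>i\<in>D. LINT y:?B i|lebesgue. h y)"
      using that C(2) by (intro sum_mono) (auto simp: K_def less_imp_le split: prod.splits)
    also have "\<dots> = (LINT y:(\<Union>i\<in>D. ?B i)|lebesgue. h y)"
      by (rule set_integral_finite_Union[symmetric]) (use that disj si in auto)
    \<comment> \<open>The intervals lie in \<open>U\<close>, and on \<open>A\<close> the function
      \<open>h\<close> is nonpositive, so discarding \<open>A\<close> can only increase the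
      integral. What remains is an integral over a set of measure below
      \<open>\<delta>\<close>.\<close>
    also have "\<dots> \<le> (LINT y:U - A|lebesgue. \<bar>h y\<bar>)"
      unfolding set_lebesgue_integral_def
    proof (rule integral_mono)
      have "(\<Union>i\<in>D. ?B i) \<in> sets lebesgue" using that by (intro sets.finite_UN) auto
      from si[OF this] show "integrable lebesgue (\<lambda>x. indicat_real (\<Union>i\<in>D. ?B i) x *\<^sub>R h x)"
        by (simp add: set_integrable_def)
      show "integrable lebesgue (\<lambda>x. indicat_real (U - A) x *\<^sub>R \<bar>h x\<bar>)"
        using h U(3) by (intro integrable_mult_indicator) auto
      have "(\<Union>i\<in>D. ?B i) \<subseteq> U" using that C(2) unfolding K_def by fastforce
      then have "x \<in> U" if "x \<in> (\<Union>i\<in>D. ?B i)" for x using that by blast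
      then show "indicat_real (\<Union>i\<in>D. ?B i) x *\<^sub>R h x \<le> indicat_real (U - A) x *\<^sub>R \<bar>h x\<bar>" for x
        by (auto simp: A_def indicator_def simp del: mem_cball)
    qed
    also have "\<dots> < \<epsilon> * r" using \<delta> U by auto
    finally show ?thesis using \<open>r > 0\<close> by (simp add: mult.commute)
  qed
  have W: "(\<Union>i\<in>C. cball (fst i) (snd i)) \<in> lmeasurable"
    "measure lebesgue (\<Union>i\<in>C. cball (fst i) (snd i)) \<le> \<epsilon>"
    using fmeasurable_UN_bound[OF C(1), of "\<lambda>i. cball (fst i) (snd i)" lebesgue \<epsilon>]
      measure_UN_bound[OF C(1), of "\<lambda>i. cball (fst i) (snd i)" lebesgue \<epsilon>] bound by auto
  let ?N = "E - (\<Union>i \<in> C. cball (fst i) (snd i))"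
  have N: "?N \<in> lmeasurable" "measure lebesgue ?N = 0"
    using C(4) by (auto simp: negligible_iff_measure)
  show "\<exists>T. E \<subseteq> T \<and> T \<in> lmeasurable \<and> measure lebesgue T \<le> \<epsilon>"
  proof (intro exI conjI)
    show "E \<subseteq> (\<Union>i\<in>C. cball (fst i) (snd i)) \<union> ?N" by auto
    show "(\<Union>i\<in>C. cball (fst i) (snd i)) \<union> ?N \<in> lmeasurable" by (rule fmeasurable.Un[OF W(1) N(1)])
    show "measure lebesgue ((\<Union>i\<in>C. cball (fst i) (snd i)) \<union> ?N) \<le> \<epsilon>"
      using measure_Un_le[OF fmeasurableD[OF W(1)] fmeasurableD[OF N(1)]] W(2) N(2) by linarith
  qed
qed

text \<open>If \<open>f t \<le> p < q\<close>, an interval with average of \<open>f\<close> above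
  \<open>q\<close> has average of \<open>f - p\<close> above \<open>q - p\<close>, while
  \<open>f - p\<close> is nonpositive at \<open>t\<close>. The covering lemma makes the set of such
  \<open>t\<close> negligible, and rational pairs \<open>(p, q)\<close> suffice. The intervals only
  have to contain \<open>t\<close>, possibly as an endpoint, which is the form that difference
  quotients of an indefinite integral take.\<close>

lemma averages_eventually_le:
  fixes f :: "real \<Rightarrow> real"
  assumes f: "f absolutely_integrable_on {a..b}"
  obtains N where "negligible N"
    "\<And>t e. t \<in> {a..b} - N \<Longrightarrow> e > 0 \<Longrightarrow> \<exists>\<delta>>0. \<forall>u v. a \<le> u \<and> u < v \<and> v \<le> b \<and> u \<le> t \<and> t \<le> v \<and> v - u < \<delta> \<longrightarrow>
       integral {u..v} f \<le> (f t + e) * (v - u)"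
proof -
  define bad where "bad p q = {t \<in> {a..b}. f t \<le> p \<and> (\<forall>\<delta>>0. \<exists>u v. a \<le> u \<and> u < v \<and> v \<le> b \<and>
      u \<le> t \<and> t \<le> v \<and> v - u < \<delta> \<and> integral {u..v} f > q * (v - u))}" for p q
  have neg: "negligible (bad p q)" if "p < q" for p q
  proof (rule negligible_large_averages[where h = "\<lambda>x. indicator {a..b} x * (f x - p)" and r = "q - p"])
    have 1: "(\<lambda>x. f x - p) absolutely_integrable_on {a..b}"
      using f by (intro set_integral_diff) auto
    then show "integrable lebesgue (\<lambda>x. indicat_real {a..b} x * (f x - p))"
      by (simp add: set_integrable_def)
    fix x \<delta> :: real assume "x \<in> bad p q" "\<delta> > 0"
    then obtain u v where uv: "a \<le> u" "u < v" "v \<le> b" "u \<le> x" "x \<le> v" "v - u < \<delta>"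
      "integral {u..v} f > q * (v - u)"
      unfolding bad_def by blast
    define c \<rho> where "c = (u + v) / 2" and "\<rho> = (v - u) / 2"
    have cb: "cball c \<rho> = {u..v}"
      by (simp add: cball_eq_atLeastAtMost c_def \<rho>_def field_simps)
    have fi: "(\<lambda>x. f x) absolutely_integrable_on {u..v}"
      using f uv by (rule_tac absolutely_integrable_on_subinterval) auto
    have ii: "(\<lambda>x. f x - p) absolutely_integrable_on {u..v}"
      using 1 uv by (rule_tac absolutely_integrable_on_subinterval) auto
    have "(LINT y:cball c \<rho>|lebesgue. indicat_real {a..b} y * (f y - p))
        = (LINT y:{u..v}|lebesgue. f y - p)"
      unfolding cb set_lebesgue_integral_def
      by (intro Bochner_Integration.integral_cong) (use uv in \<open>auto split: split_indicator\<close>)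
    also have "\<dots> = integral {u..v} (\<lambda>y. f y - p)"
      using ii by (rule set_lebesgue_integral_eq_integral)
    also have "\<dots> = integral {u..v} f - p * (v - u)"
      using fi uv by (subst Henstock_Kurzweil_Integration.integral_diff)
        (auto dest: set_lebesgue_integral_eq_integral(1))
    finally have "(LINT y:cball c \<rho>|lebesgue. indicat_real {a..b} y * (f y - p)) > (q - p) * (2 * \<rho>)"
      using uv(7) by (simp add: \<rho>_def algebra_simps)
    then show "\<exists>c \<rho>. 0 < \<rho> \<and> \<rho> < \<delta> \<and> x \<in> cball c \<rho> \<and>
       (q - p) * (2 * \<rho>) < (LINT y:cball c \<rho>|lebesgue. indicat_real {a..b} y * (f y - p))"
      using uv cb by (intro exI[of _ c] exI[of _ \<rho>]) (auto simp: \<rho>_def)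
  qed (use that in \<open>auto simp: bad_def split: split_indicator\<close>)
  define P where "P = {(p, q). p < q \<and> p \<in> (\<rat>::real set) \<and> q \<in> \<rat>}"
  define N where "N = (\<Union>(p, q)\<in>P. bad p q)"
  show ?thesis
  proof
    have "countable P"
      by (rule countable_subset[of _ "\<rat> \<times> \<rat>"]) (auto simp: P_def countable_rat)
    then have "countable ((\<lambda>(p, q). bad p q) ` P)" by auto
    then show "negligible N" unfolding N_def
      by (rule negligible_countable_Union) (auto simp: P_def neg)
    fix t and e :: real assume t: "t \<in> {a..b} - N" "e > 0"
    obtain p where p: "p \<in> \<rat>" "f t < p" "p < f t + e" using Rats_dense_in_real[of "f t" "f t + e"] t by auto
    obtain q where q: "q \<in> \<rat>" "p < q" "q < f t + e" using Rats_dense_in_real[of p "f t + e"] p by auto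
    have "t \<notin> bad p q" using t p q by (auto simp: N_def P_def)
    then obtain \<delta> where \<delta>: "\<delta> > 0" "\<And>u v. a \<le> u \<Longrightarrow> u < v \<Longrightarrow> v \<le> b \<Longrightarrow> u \<le> t \<Longrightarrow> t \<le> v
       \<Longrightarrow> v - u < \<delta> \<Longrightarrow> integral {u..v} f \<le> q * (v - u)"
      using t p unfolding bad_def by (simp add: not_less) (meson not_le)
    have "integral {u..v} f \<le> (f t + e) * (v - u)"
      if "a \<le> u \<and> u < v \<and> v \<le> b \<and> u \<le> t \<and> t \<le> v \<and> v - u < \<delta>" for u v
    proof -
      have "integral {u..v} f \<le> q * (v - u)" using that by (intro \<delta>) auto
      also have "\<dots> \<le> (f t + e) * (v - u)" using q that by (intro mult_right_mono) auto
      finally show ?thesis .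
    qed
    then show "\<exists>\<delta>>0. \<forall>u v. a \<le> u \<and> u < v \<and> v \<le> b \<and> u \<le> t \<and> t \<le> v \<and> v - u < \<delta> \<longrightarrow>
       integral {u..v} f \<le> (f t + e) * (v - u)"
      using \<delta>(1) by blast
  qed
qed

text \<open>The upper bounds on averages of \<open>f\<close> and of \<open>- f\<close> squeeze the
  difference quotients from both sides.\<close>

lemma indefinite_integral_has_derivative_ae_real:
  fixes f :: "real \<Rightarrow> real"
  assumes f: "f absolutely_integrable_on {a..b}"
  obtains N where "negligible N"
    "\<And>t. t \<in> {a..b} - N \<Longrightarrow> ((\<lambda>s. integral {a..s} f) has_real_derivative f t) (at t within {a..b})"
proof -
  have f': "(\<lambda>x. - f x) absolutely_integrable_on {a..b}"
    using f by (simp add: set_integrable_def)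
  obtain N1 where N1: "negligible N1" "\<And>t e. t \<in> {a..b} - N1 \<Longrightarrow> e > 0 \<Longrightarrow> \<exists>\<delta>>0. \<forall>u v. a \<le> u \<and> u < v \<and> v \<le> b \<and> u \<le> t \<and> t \<le> v \<and> v - u < \<delta> \<longrightarrow>
       integral {u..v} f \<le> (f t + e) * (v - u)" by (rule averages_eventually_le[OF f]) blast
  obtain N2 where N2: "negligible N2" "\<And>t e. t \<in> {a..b} - N2 \<Longrightarrow> e > 0 \<Longrightarrow> \<exists>\<delta>>0. \<forall>u v. a \<le> u \<and> u < v \<and> v \<le> b \<and> u \<le> t \<and> t \<le> v \<and> v - u < \<delta> \<longrightarrow>
       integral {u..v} (\<lambda>x. - f x) \<le> (- f t + e) * (v - u)" by (rule averages_eventually_le[OF f']) blast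
  show ?thesis
  proof
    show "negligible (N1 \<union> N2)" using N1 N2 by simp
    fix t assume t: "t \<in> {a..b} - (N1 \<union> N2)"
    show "((\<lambda>s. integral {a..s} f) has_real_derivative f t) (at t within {a..b})"
      unfolding has_field_derivative_def has_derivative_within_alt
    proof (intro conjI allI impI)
      show "bounded_linear ((*) (f t))" by (rule bounded_linear_mult_right)
      fix e :: real assume "e > 0"
      obtain d1 where d1: "d1 > 0" "\<And>u v. a \<le> u \<and> u < v \<and> v \<le> b \<and> u \<le> t \<and> t \<le> v \<and> v - u < d1 \<Longrightarrow>
       integral {u..v} f \<le> (f t + e) * (v - u)" using N1(2)[of t e] t \<open>e > 0\<close> by blast
      obtain d2 where d2: "d2 > 0" "\<And>u v. a \<le> u \<and> u < v \<and> v \<le> b \<and> u \<le> t \<and> t \<le> v \<and> v - u < d2 \<Longrightarrow>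
       integral {u..v} (\<lambda>x. - f x) \<le> (- f t + e) * (v - u)" using N2(2)[of t e] t \<open>e > 0\<close> by blast
      have key: "\<bar>integral {u..v} f - f t * (v - u)\<bar> \<le> e * (v - u)"
        if "a \<le> u \<and> u < v \<and> v \<le> b \<and> u \<le> t \<and> t \<le> v \<and> v - u < min d1 d2" for u v
        using d1(2)[of u v] d2(2)[of u v] that by (auto simp: abs_le_iff algebra_simps)
      have fi: "f integrable_on {u..v}" if "a \<le> u" "v \<le> b" for u v
        using f that by (meson absolutely_integrable_on_def atLeastatMost_subset_iff integrable_on_subinterval)
      show "\<exists>d>0. \<forall>y\<in>{a..b}. norm (y - t) < d \<longrightarrow>
          norm (integral {a..y} f - integral {a..t} f - f t * (y - t)) \<le> e * norm (y - t)"
      proof (intro exI conjI ballI impI)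
        show "min d1 d2 > 0" using d1 d2 by auto
        fix y assume y: "y \<in> {a..b}" "norm (y - t) < min d1 d2"
        consider "y = t" | "t < y" | "y < t" by linarith
        then show "norm (integral {a..y} f - integral {a..t} f - f t * (y - t)) \<le> e * norm (y - t)"
        proof cases
          case 2
          have "integral {a..t} f + integral {t..y} f = integral {a..y} f"
            by (rule Henstock_Kurzweil_Integration.integral_combine) (use 2 t y fi in auto)
          then show ?thesis using key[of t y] 2 t y by (auto simp: algebra_simps)
        next
          case 3
          have "integral {a..y} f + integral {y..t} f = integral {a..t} f"
            by (rule Henstock_Kurzweil_Integration.integral_combine) (use 3 t y fi in auto)
          then show ?thesis using key[of y t] 3 t y by (auto simp: algebra_simps abs_minus_commute)
        qed auto
      qed
    qed
  qed
qed

theorem indefinite_integral_has_derivative_ae: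
  fixes f :: "real \<Rightarrow> 'a::euclidean_space"
  assumes f: "f absolutely_integrable_on {a..b}"
  shows "AE t in lebesgue_on {a..b}.
    ((\<lambda>s. integral {a..s} f) has_vector_derivative f t) (at t within {a..b})"
proof -
  have fi: "(\<lambda>x. f x \<bullet> i) absolutely_integrable_on {a..b}" for i
    using absolutely_integrable_linear[OF f bounded_linear_inner_left] by (simp add: o_def)
  have "\<exists>N. negligible N \<and> (\<forall>t\<in>{a..b} - N.
      ((\<lambda>s. integral {a..s} (\<lambda>x. f x \<bullet> i)) has_real_derivative f t \<bullet> i) (at t within {a..b}))" for i
    using indefinite_integral_has_derivative_ae_real[OF fi[of i]] by metis
  then obtain N where N: "\<And>i. negligible (N i)" "\<And>i t. t \<in> {a..b} - N i \<Longrightarrow>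
      ((\<lambda>s. integral {a..s} (\<lambda>x. f x \<bullet> i)) has_real_derivative f t \<bullet> i) (at t within {a..b})"
    by metis
  have neg: "negligible (\<Union>i\<in>Basis. N i)" using N(1) by (intro negligible_Union) auto
  have "((\<lambda>s. integral {a..s} f) has_vector_derivative f t) (at t within {a..b})"
    if t: "t \<in> {a..b}" "t \<notin> (\<Union>i\<in>Basis. N i)" for t
    unfolding has_vector_derivative_def
  proof (subst has_derivative_componentwise_within, intro ballI)
    fix i :: 'a assume i: "i \<in> Basis"
    have "((\<lambda>s. integral {a..s} (\<lambda>x. f x \<bullet> i)) has_derivative (\<lambda>x. x *\<^sub>R f t \<bullet> i)) (at t within {a..b})"
      using N(2)[of t i] t i by (auto simp: has_field_derivative_def mult_commute_abs)
    then show "((\<lambda>s. integral {a..s} f \<bullet> i) has_derivative (\<lambda>x. x *\<^sub>R f t \<bullet> i)) (at t within {a..b})"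
    proof (rule has_derivative_transform_within[OF _ zero_less_one t(1)])
      fix s assume "s \<in> {a..b}"
      then have "f integrable_on {a..s}"
        using f by (meson absolutely_integrable_on_def atLeastAtMost_iff atLeastatMost_subset_iff integrable_on_subinterval order_refl)
      then show "integral {a..s} (\<lambda>x. f x \<bullet> i) = integral {a..s} f \<bullet> i"
        by (rule integral_component_eq)
    qed
  qed
  then show ?thesis
    using neg by (auto simp: AE_restrict_space_iff negligible_iff_null_sets intro!: AE_I')
qed

subsection \<open>Almost everywhere convergent convex combinations\<close>

text \<open>
  Closing the tail of a sequence under midpoints only is enough for the parallelogram argument, and
  properties stable under convex combinations then follow by induction.
\<close>

inductive_set mid_closure :: "(nat \<Rightarrow> 'a \<Rightarrow> 'b::real_vector) \<Rightarrow> nat \<Rightarrow> ('a \<Rightarrow> 'b) set"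
  for u :: "nat \<Rightarrow> 'a \<Rightarrow> 'b" and n :: nat where
  base: "n \<le> k \<Longrightarrow> u k \<in> mid_closure u n"
| mid: "f \<in> mid_closure u n \<Longrightarrow> g \<in> mid_closure u n \<Longrightarrow> (\<lambda>x. (1/2) *\<^sub>R (f x + g x)) \<in> mid_closure u n"

lemma mid_closure_antimono: "m \<le> n \<Longrightarrow> mid_closure u n \<subseteq> mid_closure u m"
proof
  fix f assume "f \<in> mid_closure u n" "m \<le> n"
  then show "f \<in> mid_closure u m"
    by (induction rule: mid_closure.induct) (auto intro: mid_closure.intros)
qed

lemma mid_closure_convex:
  assumes "f \<in> mid_closure u n" "convex C" "\<And>k. n \<le> k \<Longrightarrow> u k x \<in> C"
  shows "f x \<in> C"
  using assms(1)
proof induction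
  case (mid f g)
  then show ?case
    using convexD[OF \<open>convex C\<close>, of "f x" "g x" "1/2" "1/2"] by (simp add: scaleR_add_right)
qed (use assms in auto)

text \<open>The argument is that for the element of least norm in a closed convex set of a Hilbert
  space, run along a shrinking family of sets. The bound \<open>B\<close> on a finite measure space
  supplies square integrability, and \<open>q\<close> is the squared L2 norm.\<close>

theorem mid_closure_AE_convergent:
  fixes u :: "nat \<Rightarrow> 'a \<Rightarrow> 'b::euclidean_space"
  assumes M: "finite_measure M" and um [measurable]: "\<And>n. u n \<in> borel_measurable M"
    and ub: "\<And>n x. x \<in> space M \<Longrightarrow> norm (u n x) \<le> B"
  obtains f where "\<And>n. f n \<in> mid_closure u n" "AE x in M. convergent (\<lambda>n. f n x)"
proof -
  interpret finite_measure M by fact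
  define q where "q f = (LINT x|M. (norm (f x))\<^sup>2)" for f :: "'a \<Rightarrow> 'b"
  have q0: "q f \<ge> 0" for f unfolding q_def by simp
  have meas [measurable]: "f \<in> borel_measurable M" if "f \<in> mid_closure u n" for f n
    using that by induction auto
  have bd: "norm (f x) \<le> B" if "f \<in> mid_closure u n" "x \<in> space M" for f n x
    using mid_closure_convex[OF that(1), of "cball 0 B" x] ub[OF that(2)] by auto
  have int: "integrable M (\<lambda>x. (norm (f x + c *\<^sub>R g x))\<^sup>2)"
    if f: "f \<in> mid_closure u n" and g: "g \<in> mid_closure u m" for f g n m c
  proof (rule integrable_const_bound)
    show "AE x in M. norm ((norm (f x + c *\<^sub>R g x))\<^sup>2) \<le> (B + \<bar>c\<bar> * B)\<^sup>2"
    proof (rule AE_I2)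
      fix x assume x: "x \<in> space M"
      have "norm (f x + c *\<^sub>R g x) \<le> B + \<bar>c\<bar> * B"
        using norm_triangle_ineq[of "f x" "c *\<^sub>R g x"] bd[OF f x]
          mult_left_mono[OF bd[OF g x], of "\<bar>c\<bar>"] by simp
      then show "norm ((norm (f x + c *\<^sub>R g x))\<^sup>2) \<le> (B + \<bar>c\<bar> * B)\<^sup>2"
        by (simp add: power_mono)
    qed
    show "(\<lambda>x. (norm (f x + c *\<^sub>R g x))\<^sup>2) \<in> borel_measurable M"
      using meas[OF f] meas[OF g] by measurable
  qed
  have int0: "integrable M (\<lambda>x. (norm (f x))\<^sup>2)" if "f \<in> mid_closure u n" for f n
    using int[OF that that, of 0] by simp
  have parallelogram: "q (\<lambda>x. f x - g x) = 2 * q f + 2 * q g - 4 * q (\<lambda>x. (1/2) *\<^sub>R (f x + g x))"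
    if f: "f \<in> mid_closure u n" and g: "g \<in> mid_closure u m" for f g n m
  proof -
    have "q (\<lambda>x. f x - g x) + q (\<lambda>x. f x + g x) = (LINT x|M. 2 * (norm (f x))\<^sup>2 + 2 * (norm (g x))\<^sup>2)"
      unfolding q_def using int[OF f g, of "-1"] int[OF f g, of 1]
      by (subst Bochner_Integration.integral_add[symmetric])
        (auto intro!: Bochner_Integration.integral_cong simp: power2_norm_eq_inner inner_simps)
    also have "\<dots> = 2 * q f + 2 * q g"
      unfolding q_def using int0[OF f] int0[OF g] by simp
    finally have 1: "q (\<lambda>x. f x - g x) + q (\<lambda>x. f x + g x) = 2 * q f + 2 * q g" .
    have "4 * q (\<lambda>x. (1/2) *\<^sub>R (f x + g x)) = q (\<lambda>x. f x + g x)"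
      unfolding q_def by (simp add: power_divide)
    with 1 show ?thesis by linarith
  qed
  \<comment> \<open>Nearly norm-minimal elements of the shrinking midpoint closures form a Cauchy sequence.\<close>
  define a where "a n = Inf (q ` mid_closure u n)" for n
  have ne: "mid_closure u n \<noteq> {}" for n using mid_closure.base[of n n u] by auto
  have bb: "bdd_below (q ` mid_closure u n)" for n by (rule bdd_belowI[of _ 0]) (auto simp: q0)
  have a_le: "a n \<le> q f" if "f \<in> mid_closure u n" for f n
    unfolding a_def using that bb by (intro cInf_lower) auto
  have "incseq a"
    unfolding incseq_def a_def using mid_closure_antimono ne bb
    by (intro allI impI cInf_superset_mono image_mono) auto
  moreover have "a n \<le> B\<^sup>2 * measure M (space M)" for n
  proof -
    have "a n \<le> q (u n)" by (intro a_le mid_closure.base) auto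
    also have "\<dots> \<le> (LINT x|M. B\<^sup>2)"
      unfolding q_def using int0[OF mid_closure.base[of n n u]] ub
      by (intro integral_mono) (auto intro!: power_mono)
    finally show ?thesis by (simp add: mult.commute)
  qed
  ultimately obtain L where L: "a \<longlonglongrightarrow> L" "\<And>n. a n \<le> L"
    using incseq_convergent by metis
  have "\<exists>f. f \<in> mid_closure u n \<and> q f < a n + 1 / (real n + 1)" for n
    using cInf_lessD[of "q ` mid_closure u n" "a n + 1 / (real n + 1)"] ne
    by (auto simp: a_def)
  then obtain f where f: "\<And>n. f n \<in> mid_closure u n" "\<And>n. q (f n) < a n + 1 / (real n + 1)"
    by metis
  \<comment> \<open>The midpoint of \<open>f i\<close> and \<open>f j\<close> lies in
    \<open>mid_closure u n\<close>, so its \<open>q\<close> is at least \<open>a n\<close>, whereas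
    \<open>q (f i)\<close> and \<open>q (f j)\<close> exceed \<open>L\<close> by at most
    \<open>1 / (n + 1)\<close>. The parallelogram law converts this into closeness.\<close>
  have diff: "q (\<lambda>x. f i x - f j x) \<le> 4 * (L - a n + 1 / (real n + 1))" if "n \<le> i" "n \<le> j" for i j n
  proof -
    have fn: "f i \<in> mid_closure u n" "f j \<in> mid_closure u n"
      using f(1) mid_closure_antimono that by blast+
    have k: "q (f k) \<le> L + 1 / (real n + 1)" if "n \<le> k" for k
    proof -
      have "1 / (real k + 1) \<le> 1 / (real n + 1)" using that by (simp add: frac_le)
      then show ?thesis using f(2)[of k] L(2)[of k] by linarith
    qed
    show ?thesis
      using parallelogram[OF fn] a_le[OF mid_closure.mid[OF fn]] k[OF that(1)] k[OF that(2)]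
      unfolding distrib_left right_diff_distrib by linarith
  qed
  have int_f: "integrable M (f n)" for n
    by (rule integrable_const_bound[of _ B]) (use bd[OF f(1)] meas[OF f(1)] in auto)
  have "\<exists>N. \<forall>i\<ge>N. \<forall>j\<ge>N. (LINT x|M. norm (f i x - f j x)) < e" if "e > 0" for e
  proof -
    define m where "m = measure M (space M)"
    have m: "m \<ge> 0" by (simp add: m_def)
    define d where "d = e / (2 * (m + 1))"
    have d: "d > 0" "d * m < e / 2"
      using \<open>e > 0\<close> m by (auto simp: d_def field_simps)
    have "(\<lambda>n. 4 * (L - a n + 1 / (real n + 1))) \<longlonglongrightarrow> 4 * (L - L + 0)"
      by (intro tendsto_intros L LIMSEQ_inverse_real_of_nat[unfolded inverse_eq_divide of_nat_Suc add.commute[of 1]])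
    then have "\<forall>\<^sub>F n in sequentially. 4 * (L - a n + 1 / (real n + 1)) < d * (e / 2)"
      using d \<open>e > 0\<close> by (intro order_tendstoD) auto
    then obtain N where N: "4 * (L - a N + 1 / (real N + 1)) < d * (e / 2)"
      by (auto simp: eventually_sequentially)
    have "(LINT x|M. norm (f i x - f j x)) < e" if ij: "N \<le> i" "N \<le> j" for i j
    proof -
      have i2: "integrable M (\<lambda>x. (norm (f i x - f j x))\<^sup>2)"
        using int[OF f(1) f(1), of i "-1" j] by simp
      \<comment> \<open>Passage from L2 to L1 by the elementary bound
        \<open>y \<le> d + y\<^sup>2 / d\<close> for \<open>y \<ge> 0\<close>. The constant
        \<open>d\<close> integrates to less than \<open>e / 2\<close> by its choice, and
        \<open>diff\<close> makes the quadratic part smaller than \<open>e / 2\<close>.\<close>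
      have "(LINT x|M. norm (f i x - f j x)) \<le> (LINT x|M. d + (norm (f i x - f j x))\<^sup>2 / d)"
      proof (rule integral_mono)
        have "y \<le> d + y\<^sup>2 / d" if "y \<ge> 0" for y
        proof (cases "y \<le> d")
          case False
          then have "d * y \<le> y * y" using that by (intro mult_right_mono) auto
          then have "y \<le> y\<^sup>2 / d" using d by (simp add: field_simps power2_eq_square)
          then show ?thesis using d by linarith
        qed (use d in \<open>simp add: add_increasing2\<close>)
        then show "norm (f i x - f j x) \<le> d + (norm (f i x - f j x))\<^sup>2 / d" for x by simp
      qed (use i2 int_f in auto)
      also have "\<dots> = d * m + q (\<lambda>x. f i x - f j x) / d"
        using i2 by (simp add: q_def m_def mult.commute)
      also have "\<dots> < e / 2 + (d * (e / 2)) / d"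
        using d diff[OF ij] N by (intro add_strict_mono divide_strict_right_mono) auto
      also have "\<dots> = e" using d by simp
      finally show ?thesis .
    qed
    then show ?thesis by blast
  qed
  then obtain r where r: "strict_mono r" "AE x in M. Cauchy (\<lambda>i. f (r i) x)"
    using cauchy_L1_AE_cauchy_subseq[of M f] int_f by blast
  show ?thesis
  proof
    \<comment> \<open>Since \<open>r n \<ge> n\<close>, passing to the subsequence keeps the n-th
      function in the n-th tail.\<close>
    show "f (r n) \<in> mid_closure u n" for n
      using f(1)[of "r n"] mid_closure_antimono[OF seq_suble[OF r(1), of n]] by blast
    show "AE x in M. convergent (\<lambda>n. f (r n) x)"
      using r(2) by (simp add: Cauchy_convergent_iff)
  qed
qed

subsection \<open>Measurable selections\<close>

text \<open>The closest point lies in a closed set \<open>C\<close> exactly when \<open>C\<close>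
  meets \<open>G t\<close> within every rational distance from \<open>a\<close> at which
  \<open>G t\<close> itself is met. This expresses the preimage of \<open>C\<close> by countably
  many sets of the kind assumed measurable. For the converse direction, the closest point of
  \<open>G t \<inter> C\<close> is as near to \<open>a\<close> as that of \<open>G t\<close>, and
  convexity makes the latter unique.\<close>

lemma borel_measurable_closest_point:
  fixes G :: "'a \<Rightarrow> 'b::euclidean_space set"
  assumes G: "\<And>t. t \<in> space M \<Longrightarrow> convex (G t) \<and> compact (G t) \<and> G t \<noteq> {}"
    and meas: "\<And>A. closed A \<Longrightarrow> {t \<in> space M. G t \<inter> A \<noteq> {}} \<in> sets M"
  shows "(\<lambda>t. closest_point (G t) a) \<in> borel_measurable M"
  unfolding borel_eq_closed
proof (rule measurable_measure_of)
  show "(\<lambda>t. closest_point (G t) a) -` C \<inter> space M \<in> sets M" if "C \<in> {S. closed S}" for C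
  proof -
    have "closed C" using that by simp
    have eq: "(\<lambda>t. closest_point (G t) a) -` C \<inter> space M =
      (\<Inter>q\<in>\<rat>. {t \<in> space M. G t \<inter> cball a q \<noteq> {} \<longrightarrow> G t \<inter> (C \<inter> cball a q) \<noteq> {}})" (is "_ = ?R")
    proof (intro equalityI subsetI)
      fix t assume "t \<in> (\<lambda>t. closest_point (G t) a) -` C \<inter> space M"
      then have t: "t \<in> space M" "closest_point (G t) a \<in> C" by auto
      have cl: "closed (G t)" "G t \<noteq> {}" using G[OF t(1)] by (auto intro: compact_imp_closed)
      have "closest_point (G t) a \<in> G t \<inter> (C \<inter> cball a q)" if "y \<in> G t" "dist a y \<le> q" for y q
        using closest_point_in_set[OF cl] closest_point_le[OF cl(1) that(1), of a] that t by auto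
      then show "t \<in> ?R" using t(1) by (fastforce simp: disjoint_iff)
    next
      fix t assume tR: "t \<in> ?R"
      then have t: "t \<in> space M" using Rats_0 by blast
      have cl: "closed (G t)" "G t \<noteq> {}" "convex (G t)"
        using G[OF t(1)] by (auto intro: compact_imp_closed)
      let ?p = "closest_point (G t) a"
      have step: "\<exists>z. z \<in> G t \<and> z \<in> C \<and> dist a z \<le> q" if "q \<in> \<rat>" "dist a ?p \<le> q" for q
        using tR that closest_point_in_set[OF cl(1,2), of a] by fastforce
      obtain q0 where "q0 \<in> \<rat>" "dist a ?p < q0"
        using Rats_dense_in_real[of "dist a ?p" "dist a ?p + 1"] by auto
      then have ne: "G t \<inter> C \<noteq> {}" using step[of q0] by auto
      have clC: "closed (G t \<inter> C)" using cl \<open>closed C\<close> by auto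
      let ?y = "closest_point (G t \<inter> C) a"
      have y: "?y \<in> G t" "?y \<in> C" using closest_point_in_set[OF clC ne, of a] by auto
      have "dist a ?y \<le> dist a ?p"
      proof (rule ccontr)
        assume "\<not> ?thesis"
        then obtain q where "q \<in> \<rat>" "dist a ?p < q" "q < dist a ?y"
          using Rats_dense_in_real[of "dist a ?p" "dist a ?y"] by auto
        moreover then obtain z where "z \<in> G t" "z \<in> C" "dist a z \<le> q" using step[of q] by auto
        moreover then have "dist a ?y \<le> dist a z" by (intro closest_point_le clC) auto
        ultimately show False by linarith
      qed
      then have "?y = ?p"
        by (intro closest_point_unique cl y)
          (use closest_point_le[OF cl(1), of _ a] in \<open>fastforce intro: order_trans\<close>)
      then show "t \<in> (\<lambda>t. closest_point (G t) a) -` C \<inter> space M" using y t by auto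
    qed
    have "{t \<in> space M. G t \<inter> cball a q \<noteq> {} \<longrightarrow> G t \<inter> (C \<inter> cball a q) \<noteq> {}} \<in> sets M" for q
    proof -
      have "{t \<in> space M. G t \<inter> cball a q \<noteq> {} \<longrightarrow> G t \<inter> (C \<inter> cball a q) \<noteq> {}} =
        (space M - {t \<in> space M. G t \<inter> cball a q \<noteq> {}}) \<union> {t \<in> space M. G t \<inter> (C \<inter> cball a q) \<noteq> {}}"
        by blast
      then show ?thesis using meas[of "cball a q"] meas[of "C \<inter> cball a q"] \<open>closed C\<close> by auto
    qed
    then show ?thesis unfolding eq
      by (intro sets.countable_INT') (use Rats_0 in \<open>auto simp: countable_rat\<close>)
  qed
qed auto

text \<open>The Caratheodory condition speaks of inclusion in closed sets, so the complement,
  inclusion in the open set \<open>- C\<close>, has to be exhausted from inside: \<open>- C\<close>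
  is the increasing union of the closed sets \<open>A n\<close>, and a compact value inside
  \<open>- C\<close> has positive distance to \<open>C\<close>, hence already lies in one
  \<open>A n\<close>.\<close>

lemma caratheodory_hits_closed_measurable:
  fixes F :: "real \<Rightarrow> real^'n \<Rightarrow> (real^'n) set"
  assumes F: "caratheodory_map I F" and "closed C"
  shows "{t \<in> I. F t x \<inter> C \<noteq> {}} \<in> sets lebesgue"
\<comment> \<open>By convention \<open>infdist\<close> to the empty set is 0, which would make every
  \<open>A n\<close> empty; this case is therefore split off.\<close>
proof (cases "C = {}")
  case False
  define A where "A n = {y. 1 / real (Suc n) \<le> infdist y C}" for n
  have cA: "closed (A n)" for n unfolding A_def
    by (rule closed_Collect_le) (auto intro!: continuous_intros)
  have AE: "{t \<in> I. F t x \<subseteq> A n} \<in> sets lebesgue" for n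
    using F cA unfolding caratheodory_map_def by blast
  have I: "I \<in> sets lebesgue"
  proof -
    have "{t \<in> I. F t x \<subseteq> UNIV} \<in> sets lebesgue"
      using F closed_UNIV unfolding caratheodory_map_def by blast
    then show ?thesis by simp
  qed
  have "{t \<in> I. F t x \<inter> C \<noteq> {}} = I - (\<Union>n. {t \<in> I. F t x \<subseteq> A n})"
  proof (intro equalityI subsetI)
    fix t assume t: "t \<in> {t \<in> I. F t x \<inter> C \<noteq> {}}"
    then obtain y where y: "y \<in> F t x" "y \<in> C" by auto
    have "y \<notin> A n" for n using y by (simp add: A_def not_le)
    then show "t \<in> I - (\<Union>n. {t \<in> I. F t x \<subseteq> A n})" using t y by auto
  next
    fix t assume t: "t \<in> I - (\<Union>n. {t \<in> I. F t x \<subseteq> A n})"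
    have K: "compact (F t x)" "F t x \<noteq> {}" using F t unfolding caratheodory_map_def by auto
    obtain y where y: "y \<in> F t x" "\<And>z. z \<in> F t x \<Longrightarrow> infdist y C \<le> infdist z C"
      using continuous_attains_inf[OF K continuous_on_infdist[OF continuous_on_id, of _ C]] by blast
    have "infdist y C = 0"
    proof (rule ccontr)
      assume "infdist y C \<noteq> 0"
      then have "infdist y C > 0" using infdist_nonneg[of y C] by linarith
      then obtain n where "1 / real (Suc n) < infdist y C" by (meson nat_approx_posE)
      then have "F t x \<subseteq> A n" using y(2) by (force simp: A_def)
      then show False using t by auto
    qed
    then have "y \<in> C" using \<open>closed C\<close> False in_closed_iff_infdist_zero by blast
    then show "t \<in> {t \<in> I. F t x \<inter> C \<noteq> {}}" using t y by auto
  qed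
  then show ?thesis using AE I by auto
qed auto

text \<open>The selection is the element of least norm in \<open>F t x \<inter> H\<close>. Later
  \<open>H\<close> is a half-space, so that membership in \<open>H\<close> is the guiding inequality
  at the point \<open>x\<close>.\<close>

theorem caratheodory_measurable_selection:
  fixes F :: "real \<Rightarrow> real^'n \<Rightarrow> (real^'n) set"
  assumes F: "caratheodory_map I F" and I: "I \<in> sets lebesgue"
    and H: "closed H" "convex H" "\<And>t. t \<in> I \<Longrightarrow> F t x \<inter> H \<noteq> {}"
  obtains y where "y \<in> borel_measurable (lebesgue_on I)" "\<And>t. t \<in> I \<Longrightarrow> y t \<in> F t x \<inter> H"
proof
  have G: "convex (F t x \<inter> H) \<and> compact (F t x \<inter> H) \<and> F t x \<inter> H \<noteq> {}" if "t \<in> I" for t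
    using F H that unfolding caratheodory_map_def by (auto intro: convex_Int compact_Int_closed)
  show "(\<lambda>t. closest_point (F t x \<inter> H) 0) \<in> borel_measurable (lebesgue_on I)"
  proof (rule borel_measurable_closest_point)
    fix A :: "(real^'n) set" assume "closed A"
    then have "{t \<in> I. F t x \<inter> (H \<inter> A) \<noteq> {}} \<in> sets lebesgue"
      using H by (intro caratheodory_hits_closed_measurable[OF F]) auto
    then show "{t \<in> space (lebesgue_on I). F t x \<inter> H \<inter> A \<noteq> {}} \<in> sets (lebesgue_on I)"
      using I by (auto simp: sets_restrict_space_iff Int_assoc space_restrict_space)
  qed (use G in auto)
  show "closest_point (F t x \<inter> H) 0 \<in> F t x \<inter> H" if "t \<in> I" for t
    using G[OF that] closest_point_in_set[of "F t x \<inter> H" 0] by (auto intro: compact_imp_closed)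
qed

subsection \<open>Limits of approximate solutions\<close>

text \<open>The distance to a compact set is attained, so the closed neighbourhood is the Minkowski
  sum of \<open>A\<close> and a ball. Its convexity lets approximate membership in a value of
  \<open>F\<close> survive hulls and midpoints.\<close>

lemma convex_infdist_le:
  fixes A :: "'a::euclidean_space set"
  assumes "compact A" "convex A" "A \<noteq> {}"
  shows "convex {y. infdist y A \<le> r}"
proof -
  have "{y. infdist y A \<le> r} = (\<Union>a\<in>A. \<Union>b\<in>cball 0 r. {a + b})"
  proof (intro equalityI subsetI)
    fix y assume "y \<in> {y. infdist y A \<le> r}"
    moreover obtain a where "a \<in> A" "infdist y A = dist y a"
      using infdist_attains_inf[of A y] assms compact_imp_closed by blast
    ultimately show "y \<in> (\<Union>a\<in>A. \<Union>b\<in>cball 0 r. {a + b})"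
      by (auto simp: dist_norm norm_minus_commute intro!: bexI[of _ a] exI[of _ "y - a"] bexI[of _ "y - a" "cball 0 r"])
  qed (auto simp: dist_norm intro!: infdist_le2)
  then show ?thesis using convex_sums[OF assms(2) convex_cball[of 0 r]] by simp
qed

text \<open>Disjointness merges the bounds on the increments into one integral over a set of small
  measure.\<close>

lemma absolutely_continuous_fun_if_le_integral:
  fixes g :: "real \<Rightarrow> 'a::real_normed_vector"
  assumes w: "w absolutely_integrable_on {a..b}" "\<And>t. t \<in> {a..b} \<Longrightarrow> (0::real) \<le> w t"
    and g: "\<And>s t. a \<le> s \<Longrightarrow> s \<le> t \<Longrightarrow> t \<le> b \<Longrightarrow> norm (g t - g s) \<le> integral {s..t} w"
  shows "absolutely_continuous_fun a b g"
  unfolding absolutely_continuous_fun_def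
proof (intro allI impI)
  fix \<epsilon> :: real assume "\<epsilon> > 0"
  define h where "h x = indicator {a..b} x * w x" for x
  have h: "integrable lebesgue h" using w by (simp add: h_def[abs_def] set_integrable_def)
  have h0: "0 \<le> h x" for x using w by (auto simp: h_def split: split_indicator)
  obtain \<delta> where \<delta>: "\<delta> > 0"
    "\<And>A. A \<in> sets lebesgue \<Longrightarrow> emeasure lebesgue A < ennreal \<delta> \<Longrightarrow> (LINT x:A|lebesgue. h x) < \<epsilon>"
    using integral_absolutely_continuous[OF h h0 \<open>\<epsilon> > 0\<close>] by blast
  show "\<exists>\<delta>>0. \<forall>n::nat. \<forall>l u :: nat \<Rightarrow> real. (\<forall>i<n. a \<le> l i \<and> l i < u i \<and> u i \<le> b) \<longrightarrow>
        disjoint_family_on (\<lambda>i. {l i<..<u i}) {..<n} \<longrightarrow> (\<Sum>i<n. u i - l i) < \<delta> \<longrightarrow>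
        (\<Sum>i<n. norm (g (u i) - g (l i))) < \<epsilon>"
  proof (intro exI conjI allI impI)
    fix n :: nat and l u :: "nat \<Rightarrow> real"
    assume lu: "\<forall>i<n. a \<le> l i \<and> l i < u i \<and> u i \<le> b"
      and disj: "disjoint_family_on (\<lambda>i. {l i<..<u i}) {..<n}" and small: "(\<Sum>i<n. u i - l i) < \<delta>"
    let ?B = "\<Union>i<n. {l i<..<u i}"
    have "emeasure lebesgue ?B \<le> (\<Sum>i<n. emeasure lebesgue {l i<..<u i})"
      by (intro emeasure_subadditive_finite) auto
    also have "\<dots> = (\<Sum>i<n. ennreal (u i - l i))"
      by (intro sum.cong) (use lu in \<open>auto simp: less_imp_le\<close>)
    also have "\<dots> = ennreal (\<Sum>i<n. u i - l i)"
      by (intro sum_ennreal) (use lu in \<open>auto simp: less_imp_le\<close>)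
    also have "\<dots> < ennreal \<delta>" using small \<delta> by (intro ennreal_lessI)
    finally have B: "emeasure lebesgue ?B < ennreal \<delta>" .
    have "(\<Sum>i<n. norm (g (u i) - g (l i))) \<le> (\<Sum>i<n. integral {l i..u i} w)"
      by (intro sum_mono g) (use lu in \<open>auto simp: less_imp_le\<close>)
    also have "\<dots> = (\<Sum>i<n. LINT x:{l i<..<u i}|lebesgue. h x)"
    proof (intro sum.cong refl)
      fix i assume "i \<in> {..<n}"
      then have i: "a \<le> l i" "l i < u i" "u i \<le> b" using lu by auto
      have "w absolutely_integrable_on {l i..u i}"
        using w(1) i by (rule_tac absolutely_integrable_on_subinterval) auto
      then have wi: "w absolutely_integrable_on {l i<..<u i}"
        by (rule set_integrable_subset) auto
      have "(LINT x:{l i<..<u i}|lebesgue. h x) = (LINT x:{l i<..<u i}|lebesgue. w x)"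
        unfolding set_lebesgue_integral_def
        by (intro Bochner_Integration.integral_cong) (use i in \<open>auto simp: h_def split: split_indicator\<close>)
      also have "\<dots> = integral {l i<..<u i} w"
        using wi by (rule set_lebesgue_integral_eq_integral)
      also have "\<dots> = integral {l i..u i} w" by (simp add: integral_open_interval_real)
      finally show "integral {l i..u i} w = (LINT x:{l i<..<u i}|lebesgue. h x)" by simp
    qed
    also have "\<dots> = (LINT x:?B|lebesgue. h x)"
      using h disj unfolding set_integrable_def
      by (intro set_integral_finite_Union[symmetric])
        (auto simp: set_integrable_def intro: integrable_mult_indicator[where 'b = real, simplified])
    also have "\<dots> < \<epsilon>" using \<delta>(2)[OF _ B] by auto
    finally show "(\<Sum>i<n. norm (g (u i) - g (l i))) < \<epsilon>" .
  qed (use \<delta> in auto)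
qed

text \<open>Integration is linear and a ball around \<open>c\<close> is convex. The weight
  \<open>w\<close> is kept separate because the midpoints will be taken of velocities divided by
  \<open>w\<close>.\<close>

lemma mid_closure_integral:
  fixes v :: "nat \<Rightarrow> real \<Rightarrow> 'b::euclidean_space"
  assumes "f \<in> mid_closure u n"
    and u: "\<And>k. (\<lambda>r. w r *\<^sub>R u k r) integrable_on S"
      "\<And>k. n \<le> k \<Longrightarrow> norm (integral S (\<lambda>r. w r *\<^sub>R u k r) - c) \<le> e"
  shows "(\<lambda>r. w r *\<^sub>R f r) integrable_on S \<and> norm (integral S (\<lambda>r. w r *\<^sub>R f r) - c) \<le> e"
  using assms(1)
proof induction
  case (mid f g)
  have eq: "(\<lambda>r. w r *\<^sub>R ((1/2) *\<^sub>R (f r + g r))) = (\<lambda>r. (1/2) *\<^sub>R (w r *\<^sub>R f r + w r *\<^sub>R g r))"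
    by (auto simp: scaleR_add_right mult.commute)
  have i: "integral S (\<lambda>r. (1/2) *\<^sub>R (w r *\<^sub>R f r + w r *\<^sub>R g r)) - c
    = (1/2) *\<^sub>R ((integral S (\<lambda>r. w r *\<^sub>R f r) - c) + (integral S (\<lambda>r. w r *\<^sub>R g r) - c))"
  proof -
    have "- c = - ((1/2) *\<^sub>R c) - (1/2) *\<^sub>R c"
      using scaleR_add_left[of "-1/2" "-1/2" c] by simp
    moreover have "integral S (\<lambda>r. (1/2) *\<^sub>R (w r *\<^sub>R f r + w r *\<^sub>R g r))
      = (1/2) *\<^sub>R (integral S (\<lambda>r. w r *\<^sub>R f r) + integral S (\<lambda>r. w r *\<^sub>R g r))"
      using mid by (simp only: integral_cmul Henstock_Kurzweil_Integration.integral_add)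
    ultimately show ?thesis
      by (simp add: scaleR_add_right scaleR_diff_right)
  qed
  have "norm ((integral S (\<lambda>r. w r *\<^sub>R f r) - c) + (integral S (\<lambda>r. w r *\<^sub>R g r) - c)) \<le> e + e"
    using mid by (intro norm_triangle_mono) auto
  then show ?case unfolding eq i using mid by (auto intro!: integrable_add)
qed (use u in auto)

lemma AE_lebesgue_onE:
  assumes "AE t in lebesgue_on S. P t" "S \<in> sets lebesgue"
  obtains N where "negligible N" "\<And>t. t \<in> S - N \<Longrightarrow> P t"
proof -
  have "AE t in lebesgue. t \<in> S \<longrightarrow> P t"
    using assms by (simp add: AE_restrict_space_iff)
  then obtain N where "N \<in> null_sets lebesgue" "{t \<in> space lebesgue. \<not> (t \<in> S \<longrightarrow> P t)} \<subseteq> N"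
    unfolding eventually_ae_filter by blast
  then show ?thesis by (intro that[of N]) (auto simp: negligible_iff_null_sets)
qed

lemma dominated_convergence_except_negligible:
  fixes f :: "nat \<Rightarrow> 'n::euclidean_space \<Rightarrow> 'm::euclidean_space"
  assumes f: "\<And>k. f k integrable_on S" and h: "h integrable_on S"
    and le: "\<And>k x. x \<in> S \<Longrightarrow> norm (f k x) \<le> h x"
    and N: "negligible N" and conv: "\<And>x. x \<in> S - N \<Longrightarrow> (\<lambda>k. f k x) \<longlonglongrightarrow> g x"
  shows "g integrable_on S" "(\<lambda>k. integral S (f k)) \<longlonglongrightarrow> integral S g"
proof -
  define f' where "f' k x = (if x \<in> N then 0 else f k x)" for k x
  define g' where "g' x = (if x \<in> N then 0 else g x)" for x
  have f': "f' k integrable_on S" "integral S (f' k) = integral S (f k)" for k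
    using integrable_spike[OF f N, of "f' k"] integral_spike[OF N, of S "f k" "f' k"]
    by (auto simp: f'_def)
  have le': "norm (f' k x) \<le> h x" if "x \<in> S" for k x
    using le[OF that, of k] norm_ge_zero[of "f k x"] unfolding f'_def by (auto simp del: norm_ge_zero)
  have conv': "(\<lambda>k. f' k x) \<longlonglongrightarrow> g' x" if "x \<in> S" for x
    using conv[of x] that by (simp add: f'_def g'_def)
  have g': "g' integrable_on S" "(\<lambda>k. integral S (f' k)) \<longlonglongrightarrow> integral S g'"
    using dominated_convergence[OF f'(1) h le' conv'] by auto
  show "g integrable_on S" by (rule integrable_spike[OF g'(1) N]) (simp add: g'_def)
  have "integral S g' = integral S g" by (rule integral_spike[OF N]) (simp add: g'_def)
  with g'(2) show "(\<lambda>k. integral S (f k)) \<longlonglongrightarrow> integral S g" by (simp add: f')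
qed

text \<open>The common bound \<open>w\<close> gives equicontinuity through its indefinite integral
  and, after division by \<open>w\<close>, velocities bounded by 1 on a finite measure space. The
  inclusion hypothesis tolerates displaced base points, convex hulls and an error of size
  \<open>e n * w t\<close>; these are absorbed in the limit because the values are convex and
  compact and, for almost every \<open>t\<close>, upper semicontinuous in the state.\<close>

theorem caratheodory_limit_solution:
  fixes F :: "real \<Rightarrow> real^'n \<Rightarrow> (real^'n) set" and x v :: "nat \<Rightarrow> real \<Rightarrow> real^'n"
  assumes "T > 0" and F: "caratheodory_map {0..T} F"
    and w: "w integrable_on {0..T}" "\<And>t. t \<in> {0..T} \<Longrightarrow> (0::real) < w t"
    and vm: "\<And>n. v n \<in> borel_measurable (lebesgue_on {0..T})"
    and vb: "\<And>n t. t \<in> {0..T} \<Longrightarrow> norm (v n t) \<le> w t"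
    and xv: "\<And>n s t. 0 \<le> s \<Longrightarrow> s \<le> t \<Longrightarrow> t \<le> T \<Longrightarrow> x n t - x n s = integral {s..t} (v n)"
    and xb: "\<And>n t. t \<in> {0..T} \<Longrightarrow> norm (x n t) \<le> \<rho>"
    and anti: "\<And>n. x n 0 = - x n T"
    and e: "e \<longlonglongrightarrow> 0"
    and incl: "\<And>n t. t \<in> {0..T} \<Longrightarrow>
      \<exists>a \<in> convex hull (\<Union>y\<in>cball (x n t) (e n). F t y). norm (v n t - a) \<le> e n * w t"
  shows "\<exists>x. absolutely_continuous_fun 0 T x \<and>
           (AE t in lebesgue_on {0..T}.
              \<exists>v\<in>F t (x t). (x has_vector_derivative v) (at t within {0..T})) \<and>
           x 0 = - x T"
proof -
  let ?I = "{0..T}"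
  have w0: "\<And>t. t \<in> ?I \<Longrightarrow> 0 \<le> w t" using w(2) by (simp add: less_imp_le)
  have wa: "w absolutely_integrable_on ?I"
    using w(1) w0 by (intro nonnegative_absolutely_integrable_1) auto
  have ws: "w integrable_on {s..t}" if "0 \<le> s" "t \<le> T" for s t
    using w(1) that by (rule_tac integrable_on_subinterval) auto
  have wm: "w \<in> borel_measurable (lebesgue_on ?I)"
    using w(1) by (rule integrable_imp_measurable)
  have va: "v n absolutely_integrable_on ?I" for n
    by (rule measurable_bounded_by_integrable_imp_absolutely_integrable[OF vm _ w(1) vb]) auto
  have vs: "v n integrable_on {s..t}" if "0 \<le> s" "t \<le> T" for s t n
    using va that by (meson absolutely_integrable_on_def atLeastatMost_subset_iff integrable_on_subinterval)
  have xw: "norm (x n t - x n s) \<le> integral {s..t} w" if "0 \<le> s" "s \<le> t" "t \<le> T" for n s t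
    unfolding xv[OF that] by (rule integral_norm_bound_integral) (use that vs ws vb in auto)
  define W where "W t = integral {0..t} w" for t
  have W: "W t - W s = integral {s..t} w" if "0 \<le> s" "s \<le> t" "t \<le> T" for s t
    using Henstock_Kurzweil_Integration.integral_combine[of 0 s t w] ws[of 0 t] that
    by (simp add: W_def algebra_simps)
  have cW: "continuous_on ?I W"
    unfolding W_def using w(1) by (rule indefinite_integral_continuous_1)
  have xW: "norm (x n t - x n s) \<le> \<bar>W t - W s\<bar>" if "s \<in> ?I" "t \<in> ?I" for n s t
  proof (cases "s \<le> t")
    case True
    then show ?thesis using xw[of s t n] W[of s t] that by auto
  next
    case False
    then show ?thesis using xw[of t s n] W[of t s] that by (auto simp: norm_minus_commute)
  qed
  have equi: "\<exists>d. 0 < d \<and> (\<forall>n y. y \<in> ?I \<and> norm (t - y) < d \<longrightarrow> norm (x n t - x n y) < \<epsilon>)"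
    if t\<epsilon>: "t \<in> ?I" "0 < \<epsilon>" for t \<epsilon>
  proof -
    obtain d where d: "d > 0" "\<And>y. y \<in> ?I \<Longrightarrow> dist y t < d \<Longrightarrow> dist (W y) (W t) < \<epsilon>"
      using cW[unfolded continuous_on_iff, rule_format, OF t\<epsilon>] by blast
    show ?thesis
    proof (intro exI conjI allI impI)
      fix n y assume "y \<in> ?I \<and> norm (t - y) < d"
      then show "norm (x n t - x n y) < \<epsilon>"
        using d(2)[of y] xW[of y t n] t\<epsilon> by (auto simp: dist_norm abs_minus_commute)
    qed (use d in auto)
  qed
  obtain g k where g: "continuous_on ?I g" "strict_mono (k :: nat \<Rightarrow> nat)"
    "\<And>\<epsilon>. 0 < \<epsilon> \<Longrightarrow> \<exists>N. \<forall>n t. n \<ge> N \<and> t \<in> ?I \<longrightarrow> norm (x (k n) t - g t) < \<epsilon>"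
    by (rule Arzela_Ascoli[OF compact_Icc[of 0 T] xb equi]) blast+
  have lim_g: "(\<lambda>n. x (k n) t) \<longlonglongrightarrow> g t" if "t \<in> ?I" for t
    using g(3) that by (intro LIMSEQ_I) blast
  have ek: "(\<lambda>n. e (k n)) \<longlonglongrightarrow> 0" using LIMSEQ_subseq_LIMSEQ[OF e g(2)] by (simp add: o_def)
  \<comment> \<open>Normalised velocities: the uniform bound required by
    \<open>mid_closure_AE_convergent\<close> holds for \<open>u\<close>, whereas \<open>v\<close> is
    only dominated by an integrable function.\<close>
  define u where "u n t = (1 / w t) *\<^sub>R v (k n) t" for n t
  have wu: "w t *\<^sub>R u n t = v (k n) t" if "t \<in> ?I" for n t
    using w(2)[OF that] by (simp add: u_def)
  have um: "u n \<in> borel_measurable (lebesgue_on ?I)" for n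
    unfolding u_def by (intro borel_measurable_scaleR borel_measurable_divide borel_measurable_const wm vm)
  have ub: "norm (u n t) \<le> 1" if "t \<in> space (lebesgue_on ?I)" for n t
    using vb[of t "k n"] w(2)[of t] that by (simp add: u_def space_restrict_space field_simps)
  have fin: "finite_measure (lebesgue_on ?I)"
    by (intro finite_measure_lebesgue_on) simp
  obtain f where f: "\<And>n. f n \<in> mid_closure u n" "AE t in lebesgue_on ?I. convergent (\<lambda>n. f n t)"
    by (rule mid_closure_AE_convergent[where u = u, OF fin um ub]) blast+
  have fm: "f n \<in> borel_measurable (lebesgue_on ?I)" for n
    using f(1)[of n]
    by induction (auto intro!: um borel_measurable_scaleR borel_measurable_add)
  have fb: "norm (f n t) \<le> 1" if "t \<in> ?I" for n t
    using mid_closure_convex[OF f(1), where C = "cball 0 1" and x = t] ub that by (auto simp: space_restrict_space)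
  obtain N where N: "negligible N" "\<And>t. t \<in> ?I - N \<Longrightarrow> convergent (\<lambda>n. f n t)"
    using f(2) by (rule AE_lebesgue_onE) auto
  \<comment> \<open>The value 0 on the exceptional set makes the bound by \<open>w\<close> hold at
    every point of the interval, not just almost everywhere.\<close>
  define z where "z t = (if t \<in> N then 0 else lim (\<lambda>n. w t *\<^sub>R f n t))" for t
  have fz: "(\<lambda>n. w t *\<^sub>R f n t) \<longlonglongrightarrow> z t" if tN: "t \<in> ?I - N" for t
  proof -
    obtain L where "(\<lambda>n. f n t) \<longlonglongrightarrow> L" using N(2)[OF tN] by (auto simp: convergent_def)
    then have "convergent (\<lambda>n. w t *\<^sub>R f n t)"
      by (rule convergentI[OF tendsto_scaleR[OF tendsto_const]])
    then show ?thesis using tN by (simp add: z_def convergent_LIMSEQ_iff)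
  qed
  have fwb: "norm (w t *\<^sub>R f n t) \<le> w t" if "t \<in> ?I" for n t
    using mult_left_mono[OF fb[OF that] w0[OF that]] w0[OF that] by simp
  have zw: "norm (z t) \<le> w t" if "t \<in> ?I" for t
  proof (cases "t \<in> N")
    case False
    show ?thesis by (rule Lim_bounded[OF tendsto_norm[OF fz]]) (use fwb that False in auto)
  qed (use w0 that in \<open>simp add: z_def\<close>)
  have fi: "(\<lambda>r. w r *\<^sub>R f n r) absolutely_integrable_on ?I" for n
    by (rule measurable_bounded_by_integrable_imp_absolutely_integrable[OF _ _ w(1) fwb])
      (auto intro!: borel_measurable_scaleR wm fm)
  have fs: "(\<lambda>r. w r *\<^sub>R f n r) integrable_on {s..t}" if "0 \<le> s" "t \<le> T" for s t n
    using fi that by (meson absolutely_integrable_on_def atLeastatMost_subset_iff integrable_on_subinterval)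
  have zdom: "z integrable_on {s..t}"
    "(\<lambda>n. integral {s..t} (\<lambda>r. w r *\<^sub>R f n r)) \<longlonglongrightarrow> integral {s..t} z"
    if st: "0 \<le> s" "t \<le> T" for s t
  proof -
    have le: "norm (w r *\<^sub>R f n r) \<le> w r" if "r \<in> {s..t}" for n r
      using fwb that st by auto
    have conv: "(\<lambda>n. w r *\<^sub>R f n r) \<longlonglongrightarrow> z r" if "r \<in> {s..t} - N" for r
      using fz that st by auto
    show "z integrable_on {s..t}"
      "(\<lambda>n. integral {s..t} (\<lambda>r. w r *\<^sub>R f n r)) \<longlonglongrightarrow> integral {s..t} z"
      using dominated_convergence_except_negligible[OF fs[OF st] ws[OF st] le N(1) conv] by auto
  qed
  have za: "z absolutely_integrable_on ?I"
    by (rule absolutely_integrable_integrable_bound[OF zw _ w(1)]) (use zdom(1)[of 0 T] in auto)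
  \<comment> \<open>The same integrals are evaluated in two ways. Dominated convergence gives the
    integral of \<open>z\<close>; on the other hand each \<open>f n\<close> combines velocities from
    the n-th tail, whose integrals are increments of \<open>x (k m)\<close> with
    \<open>m \<ge> n\<close>, and these are already close to the increment of
    \<open>g\<close>.\<close>
  have gz: "g t - g s = integral {s..t} z" if st: "0 \<le> s" "s \<le> t" "t \<le> T" for s t
  proof -
    have "(\<lambda>n. integral {s..t} (\<lambda>r. w r *\<^sub>R f n r)) \<longlonglongrightarrow> integral {s..t} z"
      using zdom(2) st by auto
    moreover have "(\<lambda>n. integral {s..t} (\<lambda>r. w r *\<^sub>R f n r)) \<longlonglongrightarrow> g t - g s"
    proof (rule LIMSEQ_I)
      fix r :: real assume "r > 0"
      have lim: "(\<lambda>n. x (k n) t - x (k n) s) \<longlonglongrightarrow> g t - g s" using lim_g st by (intro tendsto_diff) auto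
      obtain n0 where n0: "\<And>n. n \<ge> n0 \<Longrightarrow> norm ((x (k n) t - x (k n) s) - (g t - g s)) < r / 2"
        using LIMSEQ_D[OF lim, of "r / 2"] \<open>r > 0\<close> by auto
      have eq: "integral {s..t} (\<lambda>r. w r *\<^sub>R u n r) = x (k n) t - x (k n) s" for n
        unfolding xv[OF st] by (rule Henstock_Kurzweil_Integration.integral_cong) (use wu st in auto)
      have int: "(\<lambda>r. w r *\<^sub>R u n r) integrable_on {s..t}" for n
        by (rule integrable_eq[OF vs[of s t "k n"]]) (use wu st in auto)
      have "norm (integral {s..t} (\<lambda>r. w r *\<^sub>R f n r) - (g t - g s)) < r" if "n \<ge> n0" for n
      proof -
        have "norm (integral {s..t} (\<lambda>r. w r *\<^sub>R f n r) - (g t - g s)) \<le> r / 2"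
          by (rule mid_closure_integral[OF f(1) int, THEN conjunct2])
            (use n0 that in \<open>auto simp: eq intro!: less_imp_le\<close>)
        with \<open>r > 0\<close> show ?thesis by linarith
      qed
      then show "\<exists>no. \<forall>n\<ge>no. norm (integral {s..t} (\<lambda>r. w r *\<^sub>R f n r) - (g t - g s)) < r" by blast
    qed
    ultimately show ?thesis by (rule LIMSEQ_unique[symmetric])
  qed
  have gw: "norm (g t - g s) \<le> integral {s..t} w" if "0 \<le> s" "s \<le> t" "t \<le> T" for s t
    by (rule Lim_bounded[OF tendsto_norm[OF tendsto_diff[OF lim_g lim_g]]]) (use that xw in auto)
  have AEI: "AE t in lebesgue_on ?I. t \<in> ?I" by (rule AE_I2) (simp add: space_restrict_space)
  have usc: "AE t in lebesgue_on ?I. usc_multimap (F t)" using F by (simp add: caratheodory_map_def)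
  have "AE t in lebesgue_on ?I. t \<notin> N"
    using N(1) by (auto simp: AE_restrict_space_iff negligible_iff_null_sets intro!: AE_I')
  then have fzAE: "AE t in lebesgue_on ?I. (\<lambda>n. w t *\<^sub>R f n t) \<longlonglongrightarrow> z t"
    using AEI by eventually_elim (use fz in auto)
  \<comment> \<open>For fixed \<open>t\<close>, every late \<open>v (k n) t\<close> lies within
    \<open>2 * \<eta>\<close> of \<open>F t (g t)\<close>: one \<open>\<eta>\<close> comes from
    upper semicontinuity at \<open>g t\<close>, preserved by the convex hull, the other from the
    error \<open>e (k n) * w t\<close>. The neighbourhood is convex, so the midpoints
    \<open>f n t\<close>, scaled by \<open>w t\<close>, stay in it, and so does their limit.\<close>
  have zF: "AE t in lebesgue_on ?I. z t \<in> F t (g t)"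
    using AEI usc fzAE
  proof eventually_elim
    case (elim t)
    let ?A = "F t (g t)"
    have A: "convex ?A" "compact ?A" "?A \<noteq> {}" using F elim(1) by (auto simp: caratheodory_map_def)
    have "infdist (z t) ?A \<le> 2 * \<eta>" if "\<eta> > 0" for \<eta>
    proof -
      define U where "U = {y. infdist y ?A < \<eta>}"
      have "open U" unfolding U_def by (intro open_Collect_less) (auto intro!: continuous_intros)
      then have op: "open {y. F t y \<subseteq> U}" using elim(2) by (simp add: usc_multimap_def)
      have gin: "g t \<in> {y. F t y \<subseteq> U}" using that by (auto simp: U_def)
      obtain \<delta> where \<delta>: "\<delta> > 0" "ball (g t) \<delta> \<subseteq> {y. F t y \<subseteq> U}"
        by (rule openE[OF op gin])
      have "(\<lambda>n. dist (x (k n) t) (g t) + \<bar>e (k n)\<bar>) \<longlonglongrightarrow> 0 + \<bar>0\<bar>"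
        by (rule tendsto_add[OF tendsto_dist_iff[THEN iffD1, OF lim_g[OF elim(1)]] tendsto_rabs[OF ek]])
      then have 1: "\<forall>\<^sub>F n in sequentially. dist (x (k n) t) (g t) + \<bar>e (k n)\<bar> < \<delta>"
        using \<delta> by (intro order_tendstoD) auto
      have "(\<lambda>n. e (k n) * w t) \<longlonglongrightarrow> 0 * w t" using ek by (intro tendsto_intros)
      then have 2: "\<forall>\<^sub>F n in sequentially. e (k n) * w t < \<eta>"
        using that by (intro order_tendstoD) auto
      have cvx: "convex {y. infdist y ?A \<le> r}" for r by (intro convex_infdist_le A)
      have "\<forall>\<^sub>F n in sequentially. infdist (w t *\<^sub>R u n t) ?A \<le> 2 * \<eta>"
        using 1 2
      proof eventually_elim
        case near: (elim n)
        obtain a where a: "a \<in> convex hull (\<Union>y\<in>cball (x (k n) t) (e (k n)). F t y)"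
          "norm (v (k n) t - a) \<le> e (k n) * w t" using incl[OF elim(1)] by blast
        have "(\<Union>y\<in>cball (x (k n) t) (e (k n)). F t y) \<subseteq> {y. infdist y ?A \<le> \<eta>}"
        proof (intro UN_least)
          fix y assume "y \<in> cball (x (k n) t) (e (k n))"
          then have "y \<in> ball (g t) \<delta>"
            using near(1) dist_triangle[of "g t" y "x (k n) t"] by (auto simp: dist_commute)
          then show "F t y \<subseteq> {y. infdist y ?A \<le> \<eta>}" using \<delta>(2) by (auto simp: U_def less_imp_le subset_iff)
        qed
        then have "infdist a ?A \<le> \<eta>" using a(1) hull_minimal[of _ _ convex] cvx by blast
        then show ?case
          using infdist_triangle[of "v (k n) t" ?A a] a(2) near(2) wu[OF elim(1)]
          by (auto simp: dist_norm)
      qed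
      then obtain N where N: "\<And>n. n \<ge> N \<Longrightarrow> infdist (w t *\<^sub>R u n t) ?A \<le> 2 * \<eta>"
        by (auto simp: eventually_sequentially)
      have "infdist (w t *\<^sub>R f n t) ?A \<le> 2 * \<eta>" if "n \<ge> N" for n
      proof -
        have "convex ((\<lambda>y. w t *\<^sub>R y) -` {y. infdist y ?A \<le> 2 * \<eta>})"
          by (intro convex_linear_vimage cvx) (simp add: linear_scale_self)
        then show ?thesis
          using mid_closure_convex[OF f(1)[of n], where x = t
            and C = "(\<lambda>y. w t *\<^sub>R y) -` {y. infdist y ?A \<le> 2 * \<eta>}"]
            N that by auto
      qed
      then show ?thesis
        by (intro Lim_bounded[OF tendsto_infdist[OF elim(3)]]) auto
    qed
    from this[of "\<eta> / 2" for \<eta>] have "infdist (z t) ?A \<le> 0 + \<eta>" if "\<eta> > 0" for \<eta>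
      using that by simp
    then have "infdist (z t) ?A \<le> 0" by (rule field_le_epsilon)
    then have "infdist (z t) ?A = 0" using infdist_nonneg[of "z t" ?A] by linarith
    then show ?case using in_closed_iff_infdist_zero[OF compact_imp_closed] A by blast
  qed
  have AEg: "AE t in lebesgue_on ?I. \<exists>v\<in>F t (g t). (g has_vector_derivative v) (at t within ?I)"
    using AEI zF indefinite_integral_has_derivative_ae[OF za]
  proof eventually_elim
    case (elim t)
    have "((\<lambda>s. g 0 + integral {0..s} z) has_vector_derivative 0 + z t) (at t within ?I)"
      using elim(3) by (intro has_vector_derivative_add has_vector_derivative_const)
    then have der: "((\<lambda>s. g 0 + integral {0..s} z) has_vector_derivative z t) (at t within ?I)"
      by simp
    have eq: "g s = g 0 + integral {0..s} z" if "s \<in> ?I" for s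
      using gz[of 0 s] that by (auto simp: diff_eq_eq add.commute)
    have "(g has_vector_derivative z t) (at t within ?I)"
      by (rule has_vector_derivative_transform[OF elim(1) eq der])
    with elim(2) show ?case by blast
  qed
  have "g 0 = - g T"
  proof (rule LIMSEQ_unique)
    show "(\<lambda>n. x (k n) 0) \<longlonglongrightarrow> g 0" using lim_g \<open>T > 0\<close> by auto
    show "(\<lambda>n. x (k n) 0) \<longlonglongrightarrow> - g T" unfolding anti using lim_g \<open>T > 0\<close> by (intro tendsto_minus) auto
  qed
  moreover have "absolutely_continuous_fun 0 T g"
    using wa w0 gw by (rule absolutely_continuous_fun_if_le_integral) auto
  ultimately show ?thesis using AEg by blast
qed

subsection \<open>Sublevel sets of a coercive potential\<close>

lemma C1_potential_continuous:
  assumes "C1_potential V"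
  shows "continuous_on A V" "continuous_on A (gradient V)"
proof -
  show "continuous_on A V"
    using assms by (auto simp: C1_potential_def intro!: continuous_at_imp_continuous_on differentiable_imp_continuous_within)
  show "continuous_on A (gradient V)"
    using assms continuous_on_subset[of UNIV _ A] by (auto simp: C1_potential_def)
qed

lemma coercive_sublevel_bounded:
  fixes V :: "'a::real_normed_vector \<Rightarrow> real"
  assumes "coercive V"
  obtains r where "r > 0" "\<And>x. V x \<le> c \<Longrightarrow> norm x \<le> r"
proof -
  have "\<forall>\<^sub>F x in at_infinity. V x > c"
    using assms unfolding coercive_def by (simp add: filterlim_at_top_dense)
  then obtain b where b: "\<And>x. norm x \<ge> b \<Longrightarrow> V x > c" by (auto simp: eventually_at_infinity)
  show ?thesis
  proof
    show "norm x \<le> max b 1" if "V x \<le> c" for x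
      using b[of x] that by (cases "norm x \<ge> b") auto
  qed auto
qed

lemma compact_sublevel:
  fixes V :: "'a::{real_normed_vector,heine_borel} \<Rightarrow> real"
  assumes "coercive V" "continuous_on UNIV V"
  shows "compact {x. V x \<le> c}"
proof -
  obtain r where "\<And>x. V x \<le> c \<Longrightarrow> norm x \<le> r" using coercive_sublevel_bounded[OF assms(1)] by blast
  then have "bounded {x. V x \<le> c}" by (auto simp: bounded_iff)
  moreover have "closed {x. V x \<le> c}" by (rule closed_Collect_le) (use assms in auto)
  ultimately show ?thesis by (simp add: compact_eq_bounded_closed)
qed

text \<open>Uniform continuity of the gradient on a compact ball gives one \<open>\<delta>\<close>
  for all base points, and the mean value inequality turns gradient oscillation into a first-order
  remainder. The ball has radius \<open>r + 1\<close> and \<open>\<delta> \<le> 1\<close>, so that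
  \<open>x + h\<close> stays inside.\<close>

lemma C1_potential_uniform_expansion:
  fixes V :: "real^'n \<Rightarrow> real"
  assumes V: "C1_potential V" and "e > 0"
  obtains \<delta> where "\<delta> > 0" "\<And>x h. norm x \<le> r \<Longrightarrow> norm h \<le> \<delta> \<Longrightarrow> norm (gradient V (x + h) - gradient V x) \<le> e"
    "\<And>x h. norm x \<le> r \<Longrightarrow> norm h \<le> \<delta> \<Longrightarrow> \<bar>V (x + h) - V x - gradient V x \<bullet> h\<bar> \<le> e * norm h"
proof -
  have "uniformly_continuous_on (cball 0 (r + 1)) (gradient V)"
    by (intro compact_uniformly_continuous C1_potential_continuous V compact_cball)
  then obtain d where d: "d > 0" "\<And>x y. x \<in> cball 0 (r+1) \<Longrightarrow> y \<in> cball 0 (r+1) \<Longrightarrow> dist y x < d \<Longrightarrow>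
      dist (gradient V y) (gradient V x) < e"
    unfolding uniformly_continuous_on_def using \<open>e > 0\<close> by metis
  define \<delta> where "\<delta> = min (d/2) 1"
  have \<delta>: "\<delta> > 0" "\<delta> < d" "\<delta> \<le> 1" using d(1) by (auto simp: \<delta>_def min_def)
  have 1: "norm (gradient V (x + h) - gradient V x) \<le> e" if "norm x \<le> r" "norm h \<le> \<delta>" for x h
    using d(2)[of x "x + h"] that \<delta> norm_triangle_ineq[of x h]
    by (simp add: mem_cball_0 dist_norm del: mem_cball)
  show ?thesis
  proof (rule that[OF \<delta>(1) 1])
    fix x h :: "real^'n" assume x: "norm x \<le> r" "norm h \<le> \<delta>"
    have "norm (V (x + h) - V x - (x + h - x) \<bullet> gradient V x) \<le> norm (x + h - x) * e"
    proof (rule differentiable_bound_linearization[where S = "cball x \<delta>" and f' = "\<lambda>y k. k \<bullet> gradient V y" and ?x0.0 = x])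
      show "x + t *\<^sub>R (x + h - x) \<in> cball x \<delta>" if "t \<in> {0..1}" for t
        using that x mult_mono[of "\<bar>t\<bar>" 1 "norm h" \<delta>] \<delta> by (auto simp: dist_norm)
      fix y assume y: "y \<in> cball x \<delta>"
      have "GDERIV V y :> gradient V y" using V by (intro GDERIV_gradient) (auto simp: C1_potential_def)
      then show "(V has_derivative (\<lambda>k. k \<bullet> gradient V y)) (at y within cball x \<delta>)"
        unfolding gderiv_def by (rule has_derivative_at_withinI)
      have "norm (gradient V y - gradient V x) \<le> e"
        using 1[of x "y - x"] x y by (auto simp: dist_norm norm_minus_commute)
      then have "norm (k \<bullet> gradient V y - k \<bullet> gradient V x) \<le> e * norm k" for k
        using Cauchy_Schwarz_ineq2[of k "gradient V y - gradient V x"]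
          mult_left_mono[of "norm (gradient V y - gradient V x)" e "norm k"]
        by (simp add: inner_diff_right mult.commute)
      then show "onorm ((\<lambda>k. k \<bullet> gradient V y) - (\<lambda>k. k \<bullet> gradient V x)) \<le> e"
        by (intro onorm_le) simp
    qed (use \<delta> in auto)
    then show "\<bar>V (x + h) - V x - gradient V x \<bullet> h\<bar> \<le> e * norm h"
      by (simp add: inner_commute mult.commute)
  qed
qed

lemma shell_gradient_bound:
  fixes V :: "real^'n \<Rightarrow> real"
  assumes V: "C1_potential V" "coercive V" and nz: "\<And>x. V x \<ge> a \<Longrightarrow> gradient V x \<noteq> 0"
  obtains g where "g > 0" "\<And>x. a \<le> V x \<Longrightarrow> V x \<le> b \<Longrightarrow> g \<le> norm (gradient V x)"
proof -
  have "closed {x. a \<le> V x}" by (rule closed_Collect_le) (use C1_potential_continuous[OF V(1)] in auto)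
  then have "compact ({x. a \<le> V x} \<inter> {x. V x \<le> b})"
    by (intro closed_Int_compact compact_sublevel V C1_potential_continuous)
  then have c: "compact {x. a \<le> V x \<and> V x \<le> b}" by (simp add: Int_def)
  show ?thesis
  proof (cases "{x. a \<le> V x \<and> V x \<le> b} = {}")
    case False
    obtain z where "z \<in> {x. a \<le> V x \<and> V x \<le> b}"
      "\<And>x. x \<in> {x. a \<le> V x \<and> V x \<le> b} \<Longrightarrow> norm (gradient V z) \<le> norm (gradient V x)"
      using continuous_attains_inf[OF c False, of "\<lambda>x. norm (gradient V x)"]
        C1_potential_continuous[OF V(1)] by (auto intro: continuous_intros)
    with nz show ?thesis by (intro that[of "norm (gradient V z)"]) auto
  qed (use that[of 1] in auto)
qed

text \<open>The slack \<open>\<eta>\<close> is there because the gradient steps contract the excess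
  of \<open>V\<close> over \<open>c\<close> geometrically: finitely many steps reach level
  \<open>c + \<eta>\<close>, while level \<open>c\<close> itself might only be approached. A fixed
  point of the composed map is a value of \<open>f\<close>, hence lies below \<open>c\<close>, where
  the gradient steps act as the identity.\<close>

theorem sublevel_fixed_point:
  fixes V :: "real^'n \<Rightarrow> real"
  assumes V: "C1_potential V" "coercive V" and nz: "\<And>x. V x \<ge> c \<Longrightarrow> gradient V x \<noteq> 0"
    and "\<eta> > 0" and f: "continuous_on {x. V x \<le> c + \<eta>} f" "\<And>x. V x \<le> c + \<eta> \<Longrightarrow> V (f x) \<le> c"
  obtains x where "V x \<le> c" "f x = x"
proof -
  note cV = C1_potential_continuous[OF V(1)]
  obtain \<rho> where \<rho>: "\<rho> > 0" "\<And>x. V x \<le> c + \<eta> \<Longrightarrow> norm x \<le> \<rho>"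
    using coercive_sublevel_bounded[OF V(2)] by blast
  have "bounded (V ` cball 0 \<rho>)" by (intro compact_imp_bounded compact_continuous_image cV) auto
  then obtain M0 where M0: "\<And>x. norm x \<le> \<rho> \<Longrightarrow> \<bar>V x\<bar> \<le> M0" unfolding bounded_iff by fastforce
  \<comment> \<open>An upper bound of \<open>V\<close> on the ball to which Brouwer is applied,
    raised to \<open>c + 1\<close> at least so that \<open>M - c\<close> is positive.\<close>
  define M where "M = max M0 (c + 1)"
  have M: "c < M" "\<And>x. norm x \<le> \<rho> \<Longrightarrow> V x \<le> M"
    using M0 by (force simp: M_def)+
  obtain r where r: "r > 0" "\<And>x. V x \<le> M \<Longrightarrow> norm x \<le> r"
    using coercive_sublevel_bounded[OF V(2)] by blast
  have "bounded (gradient V ` {x. V x \<le> M})"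
    by (intro compact_imp_bounded compact_continuous_image cV compact_sublevel V)
  then obtain G where G: "G > 0" "\<And>x. V x \<le> M \<Longrightarrow> norm (gradient V x) \<le> G" by (auto simp: bounded_pos)
  obtain g where g: "g > 0" "\<And>x. c \<le> V x \<Longrightarrow> V x \<le> M \<Longrightarrow> g \<le> norm (gradient V x)"
    using shell_gradient_bound[OF V nz] by metis
  obtain \<delta> where \<delta>: "\<delta> > 0"
    "\<And>x h. norm x \<le> r \<Longrightarrow> norm h \<le> \<delta> \<Longrightarrow> \<bar>V (x + h) - V x - gradient V x \<bullet> h\<bar> \<le> g / 2 * norm h"
    using C1_potential_uniform_expansion[OF V(1), of "g / 2" r] g(1) by (metis half_gt_zero)
  \<comment> \<open>The step length that keeps every displacement within \<open>\<delta>\<close>: on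
    the region \<open>V x \<le> M\<close> the excess \<open>a x\<close> is at most
    \<open>M - c\<close> and the gradient at most \<open>G\<close>.\<close>
  define s where "s = \<delta> / ((M - c) * G)"
  have s: "s > 0" "s * (M - c) * G = \<delta>" using \<delta>(1) G M by (auto simp: s_def)
  define a where "a x = max 0 (V x - c)" for x
  \<comment> \<open>A gradient step that is trivial below level c and contracts the excess over c by the factor q.\<close>
  define \<phi> where "\<phi> x = x - (s * a x) *\<^sub>R gradient V x" for x
  define q where "q = max 0 (1 - s * g\<^sup>2 / 2)"
  have q: "0 \<le> q" "q < 1" using s g by (auto simp: q_def)
  have step: "V (\<phi> x) \<le> M \<and> a (\<phi> x) \<le> q * a x" if x: "V x \<le> M" for x
  proof (cases "V x \<le> c")
    case True
    then show ?thesis using x by (simp add: a_def \<phi>_def)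
  next
    case False
    then have ax: "0 < a x" "a x = V x - c" "a x \<le> M - c" using x by (auto simp: a_def)
    let ?n = "norm (gradient V x)"
    define h where "h = - ((s * a x) *\<^sub>R gradient V x)"
    have n: "g \<le> ?n" "?n \<le> G" using g(2) G(2) x False by auto
    have nh: "norm h = s * a x * ?n" using s ax by (simp add: h_def)
    also have "\<dots> \<le> s * (M - c) * G" using s ax n g by (intro mult_mono) auto
    finally have "norm h \<le> \<delta>" using s by simp
    then have "V (x + h) - V x - gradient V x \<bullet> h \<le> g / 2 * norm h"
      using \<delta>(2)[of x h] r(2)[OF x] by linarith
    \<comment> \<open>The remainder coefficient \<open>g / 2\<close> is at most half the gradient
      norm, so the remainder consumes at most half of the first-order decrease.\<close>
    also have "\<dots> \<le> ?n / 2 * norm h" using n by (intro mult_right_mono) auto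
    finally have "V (x + h) \<le> V x - s * a x * ?n\<^sup>2 / 2"
      unfolding nh by (simp add: h_def power2_norm_eq_inner[symmetric] field_simps power2_eq_square)
    moreover have "s * a x * g\<^sup>2 \<le> s * a x * ?n\<^sup>2"
      using s ax n g by (intro mult_left_mono power_mono) auto
    ultimately have le: "V (\<phi> x) \<le> V x - s * a x * g\<^sup>2 / 2"
      by (simp add: \<phi>_def h_def)
    have "V (\<phi> x) - c \<le> a x - s * a x * g\<^sup>2 / 2" using le unfolding ax(2) by linarith
    also have "\<dots> = (1 - s * g\<^sup>2 / 2) * a x" by (simp add: algebra_simps)
    also have "\<dots> \<le> q * a x" using ax(1) by (intro mult_right_mono) (auto simp: q_def)
    finally have "a (\<phi> x) \<le> q * a x" using q ax by (simp add: a_def)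
    moreover have "0 \<le> s * a x * g\<^sup>2" using s ax by simp
    ultimately show ?thesis using le x by auto
  qed
  have iter: "V ((\<phi> ^^ n) x) \<le> M \<and> a ((\<phi> ^^ n) x) \<le> q ^ n * a x" if "V x \<le> M" for n x
  proof (induction n)
    case (Suc n)
    have "a (\<phi> ((\<phi> ^^ n) x)) \<le> q * a ((\<phi> ^^ n) x)" using step Suc by blast
    also have "\<dots> \<le> q * (q ^ n * a x)" using Suc q by (intro mult_left_mono) auto
    finally show ?case using step Suc by (simp add: mult.assoc)
  qed (use that in auto)
  obtain n where n: "q ^ n < \<eta> / (M - c)"
    using real_arch_pow_inv[of "\<eta> / (M - c)" q] q \<open>\<eta> > 0\<close> M by auto
  have small: "V ((\<phi> ^^ n) x) \<le> c + \<eta>" if x: "norm x \<le> \<rho>" for x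
  proof -
    have "a ((\<phi> ^^ n) x) \<le> q ^ n * a x" using iter M x by blast
    also have "\<dots> \<le> q ^ n * (M - c)"
      using M(1) M(2)[OF x] q by (intro mult_left_mono) (auto simp: a_def)
    also have "\<dots> \<le> \<eta>" using n M by (simp add: field_simps)
    finally show ?thesis by (simp add: a_def)
  qed
  have "continuous_on UNIV \<phi>"
    unfolding \<phi>_def a_def by (intro continuous_intros cV)
  then have c\<phi>: "continuous_on UNIV (\<phi> ^^ n)" for n
    by (induction n) (auto simp: continuous_on_id id_def intro: continuous_on_compose2)
  obtain x where x: "x \<in> cball 0 \<rho>" "f ((\<phi> ^^ n) x) = x"
  proof (rule brouwer[of "cball 0 \<rho>" "\<lambda>x. f ((\<phi> ^^ n) x)"])
    show "continuous_on (cball 0 \<rho>) (\<lambda>x. f ((\<phi> ^^ n) x))"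
      by (rule continuous_on_compose2[OF f(1) continuous_on_subset[OF c\<phi>]]) (use small in auto)
    show "(\<lambda>x. f ((\<phi> ^^ n) x)) \<in> cball 0 \<rho> \<rightarrow> cball 0 \<rho>"
    proof
      fix x :: "real^'n" assume "x \<in> cball 0 \<rho>"
      then have "V (f ((\<phi> ^^ n) x)) \<le> c" using small f(2) by auto
      then show "f ((\<phi> ^^ n) x) \<in> cball 0 \<rho>" using \<rho>(2)[of "f ((\<phi> ^^ n) x)"] \<open>\<eta> > 0\<close> by auto
    qed
  qed (use \<rho> in auto)
  have "V x \<le> c" using x small f(2)[of "(\<phi> ^^ n) x"] by auto
  then have "\<phi> x = x" by (simp add: \<phi>_def a_def)
  then have "(\<phi> ^^ n) x = x" for n by (induction n) auto
  with x have "f x = x" by simp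
  with \<open>V x \<le> c\<close> show ?thesis by (rule that)
qed

subsection \<open>Approximate solutions\<close>

text \<open>The order of quantifiers matters: \<open>C\<close> is chosen from the sublevel set
  before \<open>\<epsilon>\<close>, whereas the margin \<open>a\<close> may shrink with
  \<open>\<epsilon>\<close>. Continuity in \<open>z\<close> is stated for time integrals of
  \<open>f\<close>, the form in which an Euler step uses it.\<close>

theorem guided_continuous_approximation:
  fixes F :: "real \<Rightarrow> real^'n \<Rightarrow> (real^'n) set" and V :: "real^'n \<Rightarrow> real"
  assumes F: "caratheodory_map {0..T} F"
    and \<mu>: "\<mu> integrable_on {0..T}" "\<And>t. t \<in> {0..T} \<Longrightarrow> 0 \<le> \<mu> t"
      "\<And>t x y. t \<in> {0..T} \<Longrightarrow> y \<in> F t x \<Longrightarrow> norm y \<le> \<mu> t * (1 + norm x)"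
    and V: "C1_potential V" "coercive V"
    and nz: "\<And>x. c - 1 < V x \<Longrightarrow> gradient V x \<noteq> 0"
    and guide: "\<And>t x. t \<in> {0..T} \<Longrightarrow> c - 1 < V x \<Longrightarrow> \<exists>y\<in>F t x. 0 \<le> gradient V x \<bullet> y"
  obtains C where "C \<ge> 1"
    "\<And>\<epsilon>. \<epsilon> > 0 \<Longrightarrow> \<exists>f a. a > 0 \<and>
      (\<forall>z. (\<lambda>t. f t z) \<in> borel_measurable (lebesgue_on {0..T})) \<and>
      (\<forall>t\<in>{0..T}. \<forall>z. V z \<le> c + 1 \<longrightarrow> norm (f t z) \<le> C * (1 + \<mu> t)) \<and>
      (\<forall>s t. 0 \<le> s \<longrightarrow> t \<le> T \<longrightarrow> continuous_on {z. V z \<le> c + 1} (\<lambda>z. integral {s..t} (\<lambda>r. f r z))) \<and>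
      (\<forall>t\<in>{0..T}. \<forall>z. c - 1/2 \<le> V z \<longrightarrow> V z \<le> c + 1 \<longrightarrow> a * (C * (1 + \<mu> t)) \<le> gradient V z \<bullet> f t z) \<and>
      (\<forall>t\<in>{0..T}. \<forall>z. V z \<le> c + 1 \<longrightarrow>
        (\<exists>b \<in> convex hull (\<Union>y\<in>cball z \<epsilon>. F t y). norm (f t z - b) \<le> \<epsilon> * (C * (1 + \<mu> t))))"
proof -
  note cV = C1_potential_continuous[OF V(1)]
  let ?S = "{z. V z \<le> c + 1}"
  have cS: "compact ?S" by (intro compact_sublevel V cV)
  obtain \<rho> where \<rho>: "\<rho> > 0" "\<And>x. V x \<le> c + 1 \<Longrightarrow> norm x \<le> \<rho>"
    using coercive_sublevel_bounded[OF V(2)] by blast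
  have "bounded (gradient V ` ?S)" by (intro compact_imp_bounded compact_continuous_image cV cS)
  then obtain G where G: "G > 0" "\<And>x. V x \<le> c + 1 \<Longrightarrow> norm (gradient V x) \<le> G" by (auto simp: bounded_pos)
  have "\<And>x. c - 1/2 \<le> V x \<Longrightarrow> gradient V x \<noteq> 0" by (rule nz) linarith
  then obtain g where g: "g > 0" "\<And>x. c - 1/2 \<le> V x \<Longrightarrow> V x \<le> c + 1 \<Longrightarrow> g \<le> norm (gradient V x)"
    using shell_gradient_bound[OF V] by metis
  \<comment> \<open>The summand \<open>1 + \<rho>\<close> comes from linear growth of
    \<open>F\<close> on the sublevel set, and \<open>G\<close> from the gradient
    perturbation.\<close>
  define C where "C = 1 + \<rho> + G"
  have C: "C \<ge> 1" "1 + \<rho> \<le> C" "G \<le> C" using \<rho> G by (auto simp: C_def)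
  show ?thesis
  proof (rule that[OF C(1)])
    fix \<epsilon> :: real assume "\<epsilon> > 0"
    define \<epsilon>1 where "\<epsilon>1 = min \<epsilon> 1"
    have \<epsilon>1: "\<epsilon>1 > 0" "\<epsilon>1 \<le> \<epsilon>" "\<epsilon>1 \<le> 1" using \<open>\<epsilon> > 0\<close> by (auto simp: \<epsilon>1_def)
    \<comment> \<open>The gradient term contributes at least
      \<open>\<epsilon>1 * g\<^sup>2 * (1 + \<mu> t)\<close> to the guiding product. With this
      \<open>e\<close> the loss from using selections guided at neighbouring points is at most half
      of it, and the other half becomes the margin \<open>a\<close>.\<close>
    define e where "e = \<epsilon>1 * g\<^sup>2 / (2 * C)"
    have e: "e > 0" using \<epsilon>1 g C by (simp add: e_def)
    have eC: "e * C = \<epsilon>1 * g\<^sup>2 / 2" using C by (simp add: e_def)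
    obtain \<delta>0 where \<delta>0: "\<delta>0 > 0"
      "\<And>x h. norm x \<le> \<rho> \<Longrightarrow> norm h \<le> \<delta>0 \<Longrightarrow> norm (gradient V (x + h) - gradient V x) \<le> e"
      "\<And>x h. norm x \<le> \<rho> \<Longrightarrow> norm h \<le> \<delta>0 \<Longrightarrow> \<bar>V (x + h) - V x - gradient V x \<bullet> h\<bar> \<le> e * norm h"
      using C1_potential_uniform_expansion[OF V(1) e, of \<rho>] by metis
    \<comment> \<open>The three bounds serve the gradient oscillation, the radius of the inclusion,
      and a variation of \<open>V\<close> of at most 1/4. By the last one, a net point
      \<open>d\<close> near some \<open>z\<close> with \<open>V z \<ge> c - 1/2\<close> has
      \<open>V d > c - 1\<close> and is therefore guided.\<close>
    define \<delta> where "\<delta> = min (min \<delta>0 \<epsilon>) (1 / (4 * (G + e)))"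
    have \<delta>: "\<delta> > 0" "\<delta> \<le> \<delta>0" "\<delta> \<le> \<epsilon>" using \<delta>0 \<open>\<epsilon> > 0\<close> G e by (auto simp: \<delta>_def)
    have "(G + e) * \<delta> \<le> (G + e) * (1 / (4 * (G + e)))"
      using G e by (intro mult_left_mono) (auto simp: \<delta>_def)
    also have "\<dots> = 1 / 4" using G e by (simp add: field_simps)
    finally have \<delta>4: "(G + e) * \<delta> \<le> 1 / 4" .
    have near: "\<bar>V z - V d\<bar> \<le> 1/4 \<and> norm (gradient V z - gradient V d) \<le> e"
      if "V d \<le> c + 1" "dist z d < \<delta>" for z d
    proof -
      have n: "norm (z - d) \<le> \<delta>" "norm (z - d) \<le> \<delta>0" using that \<delta> by (auto simp: dist_norm)
      have "\<bar>gradient V d \<bullet> (z - d)\<bar> \<le> G * norm (z - d)"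
        using Cauchy_Schwarz_ineq2[of "gradient V d" "z - d"] G(2)[OF that(1)]
          mult_right_mono[of "norm (gradient V d)" G "norm (z - d)"] by auto
      moreover have "\<bar>V z - V d - gradient V d \<bullet> (z - d)\<bar> \<le> e * norm (z - d)"
        using \<delta>0(3)[OF \<rho>(2)[OF that(1)] n(2)] by simp
      ultimately have "\<bar>V z - V d\<bar> \<le> (G + e) * norm (z - d)" unfolding distrib_right by linarith
      also have "\<dots> \<le> (G + e) * \<delta>" using n G e by (intro mult_left_mono) auto
      finally show ?thesis using \<delta>4 \<delta>0(2)[OF \<rho>(2)[OF that(1)] n(2)] by simp
    qed
    have "\<exists>D. finite D \<and> D \<subseteq> ?S \<and> ?S \<subseteq> (\<Union>d\<in>D. ball d \<delta>)"
      using seq_compact_imp_totally_bounded[OF compact_imp_seq_compact[OF cS]] \<delta>(1) by simp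
    then obtain D where D: "finite D" "D \<subseteq> ?S" "?S \<subseteq> (\<Union>d\<in>D. ball d \<delta>)"
      by (elim exE conjE)
    \<comment> \<open>A half-space where guidance is available and the whole space elsewhere, so
      that one selection lemma covers all net points.\<close>
    define H where "H d = {v. c - 1 < V d \<longrightarrow> 0 \<le> gradient V d \<bullet> v}" for d
    have H_eq: "H d = (if c - 1 < V d then {v. gradient V d \<bullet> v \<ge> 0} else UNIV)" for d
      by (auto simp: H_def)
    have H: "closed (H d)" "convex (H d)" for d
      by (simp_all add: H_eq closed_halfspace_ge convex_halfspace_ge)
    have ne: "F t d \<inter> H d \<noteq> {}" if "t \<in> {0..T}" for t d
    proof (cases "c - 1 < V d")
      case True
      then show ?thesis using guide[OF that True] by (auto simp: H_def)
    next
      case False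
      have "F t d \<noteq> {}" using F that by (simp add: caratheodory_map_def)
      then show ?thesis using False by (simp add: H_eq)
    qed
    have "\<exists>y. y \<in> borel_measurable (lebesgue_on {0..T}) \<and> (\<forall>t\<in>{0..T}. y t \<in> F t d \<inter> H d)" for d
      by (rule caratheodory_measurable_selection[OF F _ H ne, of d]) auto
    then obtain y where y0: "\<And>d. y d \<in> borel_measurable (lebesgue_on {0..T})"
      "\<And>d t. t \<in> {0..T} \<Longrightarrow> y d t \<in> F t d \<inter> H d" by metis
    have y: "\<And>d. y d \<in> borel_measurable (lebesgue_on {0..T})"
      "\<And>d t. t \<in> {0..T} \<Longrightarrow> y d t \<in> F t d"
      "\<And>d t. t \<in> {0..T} \<Longrightarrow> c - 1 < V d \<Longrightarrow> 0 \<le> gradient V d \<bullet> y d t"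
      using y0 by (auto simp: H_def)
    have yb: "norm (y d t) \<le> (1 + \<rho>) * (1 + \<mu> t)" if "t \<in> {0..T}" "d \<in> D" for d t
    proof -
      have "norm (y d t) \<le> \<mu> t * (1 + norm d)" using \<mu>(3) y(2) that by blast
      also have "\<dots> \<le> (1 + \<mu> t) * (1 + \<rho>)"
        using \<mu>(2) that \<rho>(2)[of d] D(2) by (intro mult_mono) auto
      finally show ?thesis by (simp add: mult.commute)
    qed
    \<comment> \<open>Tent functions around the net points; normalised they form a partition of
      unity on the sublevel set, where their sum is positive because \<open>D\<close> is a
      \<open>\<delta>\<close>-net.\<close>
    define l where "l d z = max 0 (\<delta> - dist z d)" for d z :: "real^'n"
    define p where "p d z = l d z / (\<Sum>d\<in>D. l d z)" for d z
    have l0: "l d z \<ge> 0" for d z by (simp add: l_def)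
    have ls: "(\<Sum>d\<in>D. l d z) > 0" if z: "V z \<le> c + 1" for z
    proof -
      obtain d where "d \<in> D" "dist d z < \<delta>" using D(3) z by (auto simp: subset_iff)
      then have "0 < l d z" by (simp add: l_def dist_commute)
      then show ?thesis using D(1) \<open>d \<in> D\<close> l0 by (intro sum_pos2[of D d]) auto
    qed
    have p0: "p d z \<ge> 0" for d z unfolding p_def by (intro divide_nonneg_nonneg sum_nonneg l0)
    have p1: "(\<Sum>d\<in>D. p d z) = 1" if "V z \<le> c + 1" for z
      using ls[OF that] by (simp add: p_def sum_divide_distrib[symmetric])
    have pd: "dist z d < \<delta>" if "p d z \<noteq> 0" for d z
      using that by (auto simp: p_def l_def max_def split: if_splits)
    have cp: "continuous_on ?S (p d)" for d
      unfolding p_def by (intro continuous_on_divide continuous_on_sum)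
        (use ls in \<open>force simp: l_def intro!: continuous_intros\<close>)+
    define q where "q t z = (\<Sum>d\<in>D. p d z *\<^sub>R y d t)" for t z
    define f where "f t z = q t z + (\<epsilon>1 * (1 + \<mu> t)) *\<^sub>R gradient V z" for t z
    have \<mu>m: "\<mu> \<in> borel_measurable (lebesgue_on {0..T})"
      using \<mu>(1) by (rule integrable_imp_measurable)
    have fm: "(\<lambda>t. f t z) \<in> borel_measurable (lebesgue_on {0..T})" for z
      unfolding f_def q_def
      by (intro borel_measurable_add borel_measurable_sum borel_measurable_scaleR
          borel_measurable_times borel_measurable_const y \<mu>m)
    have qb: "norm (q t z) \<le> (1 + \<rho>) * (1 + \<mu> t)" if "t \<in> {0..T}" "V z \<le> c + 1" for t z
    proof -
      have "norm (q t z) \<le> (\<Sum>d\<in>D. p d z * ((1 + \<rho>) * (1 + \<mu> t)))"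
        unfolding q_def
        by (intro sum_norm_le) (use p0 yb that in \<open>auto intro!: mult_left_mono\<close>)
      also have "\<dots> = (1 + \<rho>) * (1 + \<mu> t)" using p1 that by (simp add: sum_distrib_right[symmetric])
      finally show ?thesis .
    qed
    have rest: "norm (f t z - q t z) \<le> \<epsilon>1 * (G * (1 + \<mu> t))" if "t \<in> {0..T}" "V z \<le> c + 1" for t z
    proof -
      have "norm (f t z - q t z) = \<epsilon>1 * (1 + \<mu> t) * norm (gradient V z)"
        using \<epsilon>1 \<mu>(2)[OF that(1)] by (simp add: f_def)
      also have "\<dots> \<le> \<epsilon>1 * (1 + \<mu> t) * G"
        using \<epsilon>1 \<mu>(2)[OF that(1)] G(2)[OF that(2)] by (intro mult_left_mono) auto
      finally show ?thesis by (simp add: mult_ac)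
    qed
    have fb: "norm (f t z) \<le> C * (1 + \<mu> t)" if "t \<in> {0..T}" "V z \<le> c + 1" for t z
    proof -
      have "\<epsilon>1 * (G * (1 + \<mu> t)) \<le> G * (1 + \<mu> t)"
        using \<epsilon>1 G \<mu>(2)[OF that(1)] by (intro mult_left_le_one_le) auto
      moreover have "norm (f t z) \<le> norm (q t z) + norm (f t z - q t z)"
        using norm_triangle_ineq[of "q t z" "f t z - q t z"] by simp
      ultimately have "norm (f t z) \<le> (1 + \<rho>) * (1 + \<mu> t) + G * (1 + \<mu> t)"
        using qb[OF that] rest[OF that] by linarith
      then show ?thesis by (simp add: C_def algebra_simps)
    qed
    \<comment> \<open>For fixed \<open>s\<close> and \<open>t\<close> the integral is a finite
      combination of the weights \<open>p d z\<close> and of the gradient at \<open>z\<close>, with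
      fixed integrals as coefficients.\<close>
    have fc: "continuous_on ?S (\<lambda>z. integral {s..t} (\<lambda>r. f r z))" if "0 \<le> s" "t \<le> T" for s t
    proof -
      have \<mu>i: "\<mu> integrable_on {s..t}"
        using \<mu>(1) that by (rule_tac integrable_on_subinterval) auto
      then have \<mu>i1: "(\<lambda>r. 1 + \<mu> r) integrable_on {s..t}" by (intro integrable_add) auto
      have yi: "y d integrable_on {s..t}" if "d \<in> D" for d
      proof -
        have "(\<lambda>r. (1 + \<rho>) * (1 + \<mu> r)) integrable_on {0..T}"
          using \<mu>(1) by (intro integrable_on_mult_right integrable_add) auto
        then have "y d integrable_on {0..T}"
          by (rule measurable_bounded_by_integrable_imp_integrable[OF y(1) _ yb]) (use \<open>d \<in> D\<close> in auto)
        then show ?thesis using \<open>0 \<le> s\<close> \<open>t \<le> T\<close> by (rule_tac integrable_on_subinterval) auto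
      qed
      have "integral {s..t} (\<lambda>r. f r z) =
        (\<Sum>d\<in>D. p d z *\<^sub>R integral {s..t} (y d)) + integral {s..t} (\<lambda>r. \<epsilon>1 * (1 + \<mu> r)) *\<^sub>R gradient V z" for z
      proof (rule integral_unique)
        show "((\<lambda>r. f r z) has_integral (\<Sum>d\<in>D. p d z *\<^sub>R integral {s..t} (y d)) +
            integral {s..t} (\<lambda>r. \<epsilon>1 * (1 + \<mu> r)) *\<^sub>R gradient V z) {s..t}"
          unfolding f_def q_def
          by (intro has_integral_add has_integral_sum D has_integral_cmul has_integral_scaleR_left
              integrable_integral yi)
            (use integrable_on_mult_right[OF \<mu>i1] in auto)
      qed
      then show ?thesis by (simp only:) (intro continuous_intros cp cV)
    qed
    define a where "a = \<epsilon>1 * g\<^sup>2 / (2 * C)"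
    have a: "a > 0" "a * C = \<epsilon>1 * g\<^sup>2 / 2" using e eC by (auto simp: a_def e_def)
    have fg: "a * (C * (1 + \<mu> t)) \<le> gradient V z \<bullet> f t z"
      if t: "t \<in> {0..T}" and z: "c - 1/2 \<le> V z" "V z \<le> c + 1" for t z
    proof -
      have m: "0 \<le> 1 + \<mu> t" using \<mu>(2)[OF t] by simp
      have 1: "- (e * ((1 + \<rho>) * (1 + \<mu> t))) \<le> gradient V z \<bullet> y d t" if d: "d \<in> D" "dist z d < \<delta>" for d
      proof -
        have Vd: "V d \<le> c + 1" using d D by auto
        have "c - 1 < V d" using near[OF Vd d(2)] z by linarith
        then have "0 \<le> gradient V d \<bullet> y d t" using y(3) t by blast
        moreover have "\<bar>(gradient V z - gradient V d) \<bullet> y d t\<bar> \<le> e * ((1 + \<rho>) * (1 + \<mu> t))"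
          by (rule order_trans[OF Cauchy_Schwarz_ineq2 mult_mono])
            (use near[OF Vd d(2)] yb[OF t d(1)] e in auto)
        ultimately show ?thesis unfolding inner_diff_left by linarith
      qed
      have "- (e * ((1 + \<rho>) * (1 + \<mu> t))) = (\<Sum>d\<in>D. p d z * (- (e * ((1 + \<rho>) * (1 + \<mu> t)))))"
        using p1[OF z(2)] by (simp only: sum_distrib_right[symmetric])
      also have "\<dots> \<le> (\<Sum>d\<in>D. p d z * (gradient V z \<bullet> y d t))"
      proof (rule sum_mono)
        show "p d z * (- (e * ((1 + \<rho>) * (1 + \<mu> t)))) \<le> p d z * (gradient V z \<bullet> y d t)" if "d \<in> D" for d
        proof (cases "p d z = 0")
          case False
          show ?thesis by (rule mult_left_mono[OF 1[OF that pd[OF False]] p0])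
        qed simp
      qed
      also have "\<dots> = gradient V z \<bullet> q t z" by (simp add: q_def inner_sum_right)
      finally have A: "- (e * ((1 + \<rho>) * (1 + \<mu> t))) \<le> gradient V z \<bullet> q t z" .
      have B: "e * ((1 + \<rho>) * (1 + \<mu> t)) \<le> \<epsilon>1 * g\<^sup>2 / 2 * (1 + \<mu> t)"
        unfolding eC[symmetric] mult.assoc using C e m by (intro mult_left_mono mult_right_mono) auto
      have "g\<^sup>2 \<le> (norm (gradient V z))\<^sup>2" using g z by (intro power_mono) auto
      then have "\<epsilon>1 * (1 + \<mu> t) * g\<^sup>2 \<le> \<epsilon>1 * (1 + \<mu> t) * (gradient V z \<bullet> gradient V z)"
        using \<epsilon>1 m by (intro mult_left_mono) (auto simp: power2_norm_eq_inner)
      also have "\<dots> = gradient V z \<bullet> f t z - gradient V z \<bullet> q t z"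
        by (simp add: f_def inner_add_right)
      finally have "\<epsilon>1 * g\<^sup>2 / 2 * (1 + \<mu> t) \<le> gradient V z \<bullet> f t z"
        using A B by (simp add: field_simps)
      then show ?thesis unfolding a(2)[symmetric] mult.assoc .
    qed
    have fh: "\<exists>b \<in> convex hull (\<Union>y\<in>cball z \<epsilon>. F t y). norm (f t z - b) \<le> \<epsilon> * (C * (1 + \<mu> t))"
      if t: "t \<in> {0..T}" and z: "V z \<le> c + 1" for t z
    \<comment> \<open>The witness is \<open>q t z\<close>, a convex combination of selections at net
      points within \<open>\<delta> \<le> \<epsilon>\<close> of \<open>z\<close>; the gradient term
      is the error.\<close>
    proof
      have m: "0 \<le> 1 + \<mu> t" using \<mu>(2)[OF t] by simp
      have "q t z = (\<Sum>d\<in>{d\<in>D. p d z \<noteq> 0}. p d z *\<^sub>R y d t)"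
        unfolding q_def using D(1) by (intro sum.mono_neutral_right) auto
      also have "\<dots> \<in> convex hull (\<Union>y\<in>cball z \<epsilon>. F t y)"
      proof (rule convex_sum)
        show "(\<Sum>d\<in>{d\<in>D. p d z \<noteq> 0}. p d z) = 1"
          unfolding p1[OF z, symmetric] using D(1) by (intro sum.mono_neutral_left) auto
        show "y d t \<in> convex hull (\<Union>y\<in>cball z \<epsilon>. F t y)" if "d \<in> {d\<in>D. p d z \<noteq> 0}" for d
          using that pd[of d z] \<delta> y(2)[OF t, of d] by (intro hull_inc) force
      qed (use D p0 in auto)
      finally show "q t z \<in> convex hull (\<Union>y\<in>cball z \<epsilon>. F t y)" .
      have "\<epsilon>1 * (G * (1 + \<mu> t)) \<le> \<epsilon> * (C * (1 + \<mu> t))"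
        using \<epsilon>1 G C m by (intro mult_mono) auto
      then show "norm (f t z - q t z) \<le> \<epsilon> * (C * (1 + \<mu> t))" using rest[OF t z] by linarith
    qed
    show "\<exists>f a. a > 0 \<and>
      (\<forall>z. (\<lambda>t. f t z) \<in> borel_measurable (lebesgue_on {0..T})) \<and>
      (\<forall>t\<in>{0..T}. \<forall>z. V z \<le> c + 1 \<longrightarrow> norm (f t z) \<le> C * (1 + \<mu> t)) \<and>
      (\<forall>s t. 0 \<le> s \<longrightarrow> t \<le> T \<longrightarrow> continuous_on {z. V z \<le> c + 1} (\<lambda>z. integral {s..t} (\<lambda>r. f r z))) \<and>
      (\<forall>t\<in>{0..T}. \<forall>z. c - 1/2 \<le> V z \<longrightarrow> V z \<le> c + 1 \<longrightarrow> a * (C * (1 + \<mu> t)) \<le> gradient V z \<bullet> f t z) \<and>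
      (\<forall>t\<in>{0..T}. \<forall>z. V z \<le> c + 1 \<longrightarrow>
        (\<exists>b \<in> convex hull (\<Union>y\<in>cball z \<epsilon>. F t y). norm (f t z - b) \<le> \<epsilon> * (C * (1 + \<mu> t))))"
      by (intro exI[of _ f] exI[of _ a] conjI allI ballI impI a(1) fm fb fc fg fh)
  qed
qed

text \<open>An Euler step freezes the state but integrates exactly in time, so integrability in
  \<open>t\<close> is enough and each step is continuous in the state by \<open>fc\<close>. Since
  \<open>f\<close> is bounded by \<open>w\<close>, the size of a step is measured by the
  \<open>w\<close>-mass \<open>W k\<close> of its cell rather than by its length.\<close>

theorem euler_antiperiodic:
  fixes f :: "real \<Rightarrow> real^'n \<Rightarrow> real^'n" and V :: "real^'n \<Rightarrow> real"
  assumes "T > 0" and V: "C1_potential V" "coercive V" and even: "\<And>x. V (- x) = V x"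
    and nz: "\<And>x. c \<le> V x \<Longrightarrow> gradient V x \<noteq> 0"
    and w: "w integrable_on {0..T}" "\<And>t. t \<in> {0..T} \<Longrightarrow> (1::real) \<le> w t"
    and fm: "\<And>z. V z \<le> c + 1 \<Longrightarrow> (\<lambda>t. f t z) \<in> borel_measurable (lebesgue_on {0..T})"
    and fb: "\<And>t z. t \<in> {0..T} \<Longrightarrow> V z \<le> c + 1 \<Longrightarrow> norm (f t z) \<le> w t"
    and fc: "\<And>s t. 0 \<le> s \<Longrightarrow> s \<le> t \<Longrightarrow> t \<le> T \<Longrightarrow>
      continuous_on {z. V z \<le> c + 1} (\<lambda>z. integral {s..t} (\<lambda>r. f r z))"
    and "a > 0" and fg: "\<And>t z. t \<in> {0..T} \<Longrightarrow> c - 1/2 \<le> V z \<Longrightarrow> V z \<le> c + 1 \<Longrightarrow>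
      a * w t \<le> gradient V z \<bullet> f t z"
    and "\<gamma> > 0"
  obtains x \<zeta> where "(\<lambda>t. f t (\<zeta> t)) \<in> borel_measurable (lebesgue_on {0..T})"
    "\<And>t. t \<in> {0..T} \<Longrightarrow> V (\<zeta> t) \<le> c + 1" "\<And>t. t \<in> {0..T} \<Longrightarrow> norm (x t - \<zeta> t) \<le> \<gamma>"
    "\<And>s t. 0 \<le> s \<Longrightarrow> s \<le> t \<Longrightarrow> t \<le> T \<Longrightarrow> x t - x s = integral {s..t} (\<lambda>t. f t (\<zeta> t))"
    "x 0 = - x T"
proof -
  note cV = C1_potential_continuous[OF V(1)]
  let ?S = "{z. V z \<le> c + 1}"
  obtain \<rho> where \<rho>: "\<rho> > 0" "\<And>x. V x \<le> c + 1 \<Longrightarrow> norm x \<le> \<rho>"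
    using coercive_sublevel_bounded[OF V(2)] by blast
  have "bounded (gradient V ` ?S)"
    by (intro compact_imp_bounded compact_continuous_image cV compact_sublevel V)
  then obtain G where G: "G > 0" "\<And>x. V x \<le> c + 1 \<Longrightarrow> norm (gradient V x) \<le> G" by (auto simp: bounded_pos)
  have "a / 2 > 0" using \<open>a > 0\<close> by simp
  then obtain \<delta>0 where \<delta>0: "\<delta>0 > 0"
    "\<And>x h. norm x \<le> \<rho> \<Longrightarrow> norm h \<le> \<delta>0 \<Longrightarrow> \<bar>V (x + h) - V x - gradient V x \<bullet> h\<bar> \<le> a / 2 * norm h"
    using C1_potential_uniform_expansion[OF V(1), of "a / 2" \<rho>] by metis
  \<comment> \<open>Bounds for the displacement in one step: \<open>\<delta>0\<close> controls the
    first-order remainder, \<open>\<gamma>\<close> the distance between polygon and frozen state,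
    and the third bound the change of \<open>V\<close> by at most 1/4.\<close>
  define \<delta> where "\<delta> = min (min \<delta>0 \<gamma>) (1 / (4 * (G + a / 2)))"
  have \<delta>: "\<delta> > 0" "\<delta> \<le> \<delta>0" "\<delta> \<le> \<gamma>"
    using \<delta>0 \<open>\<gamma> > 0\<close> G \<open>a > 0\<close> by (auto simp: \<delta>_def)
  have "(G + a / 2) * \<delta> \<le> (G + a / 2) * (1 / (4 * (G + a / 2)))"
    using G \<open>a > 0\<close> by (intro mult_left_mono) (auto simp: \<delta>_def)
  also have "\<dots> = 1 / 4" using G \<open>a > 0\<close> by (simp add: field_simps)
  finally have \<delta>4: "(G + a / 2) * \<delta> \<le> 1 / 4" .
  have ws: "w integrable_on {s..t}" if "0 \<le> s" "t \<le> T" for s t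
    using w(1) that by (rule_tac integrable_on_subinterval) auto
  have fs: "(\<lambda>r. f r z) integrable_on {s..t}" if "0 \<le> s" "t \<le> T" "V z \<le> c + 1" for s t z
  proof -
    have "(\<lambda>r. f r z) integrable_on {0..T}"
      by (rule measurable_bounded_by_integrable_imp_integrable[OF fm w(1) fb]) (use that in auto)
    then show ?thesis using that by (rule_tac integrable_on_subinterval) auto
  qed
  have "uniformly_continuous_on {0..T} (\<lambda>t. integral {0..t} w)"
    by (intro compact_uniformly_continuous indefinite_integral_continuous_1 w) auto
  then obtain d where d: "d > 0" "\<And>s t. s \<in> {0..T} \<Longrightarrow> t \<in> {0..T} \<Longrightarrow> dist t s < d
      \<Longrightarrow> dist (integral {0..t} w) (integral {0..s} w) < \<delta>"
    unfolding uniformly_continuous_on_def using \<delta>(1) by metis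
  \<comment> \<open>Cells shorter than \<open>d\<close> have \<open>w\<close>-mass below
    \<open>\<delta>\<close>; the maximum with 1 makes \<open>N\<close> positive.\<close>
  obtain N :: nat where "max 1 (T / d) < real N"
    using reals_Archimedean2 by blast
  then have N: "N > 0" "T / d < real N" by auto
  \<comment> \<open>The grid runs backwards from T, since V decreases backwards in time.\<close>
  define t where "t k = T - real k * T / real N" for k
  have t0: "t 0 = T" "t N = 0" using N by (auto simp: t_def)
  have tS: "t (Suc k) < t k" for k using N \<open>T > 0\<close> by (simp add: t_def divide_strict_right_mono)
  have tI: "0 \<le> t k" "t k \<le> T" if "k \<le> N" for k
  proof -
    have "real k * T / real N \<le> real N * T / real N"
      using that \<open>T > 0\<close> by (intro divide_right_mono mult_right_mono) auto
    then show "0 \<le> t k" "t k \<le> T" using N \<open>T > 0\<close> by (auto simp: t_def)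
  qed
  define W where "W k = integral {t (Suc k)..t k} w" for k
  have W: "0 < W k" "W k \<le> \<delta>" if "k < N" for k
  proof -
    have k: "0 \<le> t (Suc k)" "t k \<le> T" "t (Suc k) \<le> T" "0 \<le> t k"
      using tI[of k] tI[of "Suc k"] that by auto
    have "integral {t (Suc k)..t k} (\<lambda>_. 1) \<le> W k"
      unfolding W_def by (rule integral_le) (use ws k w(2) in auto)
    then show "0 < W k" using tS[of k] by simp
    have "integral {0..t (Suc k)} w + W k = integral {0..t k} w"
      unfolding W_def by (rule Henstock_Kurzweil_Integration.integral_combine) (use k tS[of k] ws in auto)
    moreover have "t k - t (Suc k) < d"
    proof -
      have "t k - t (Suc k) = T / real N" by (simp add: t_def distrib_right add_divide_distrib)
      also have "\<dots> < d" using N d(1) by (simp add: field_simps)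
      finally show ?thesis .
    qed
    then have "dist (t k) (t (Suc k)) < d" using tS[of k] by (simp add: dist_real_def)
    then have "dist (integral {0..t k} w) (integral {0..t (Suc k)} w) < \<delta>"
      using k by (intro d(2)) auto
    ultimately show "W k \<le> \<delta>" by (simp add: dist_real_def)
  qed
  define E where "E k z = z - integral {t (Suc k)..t k} (\<lambda>r. f r z)" for k z
  have Eb: "norm (integral {t (Suc k)..t k} (\<lambda>r. f r z)) \<le> W k" if "k < N" "V z \<le> c + 1" for k z
    unfolding W_def
    by (rule integral_norm_bound_integral) (use fs ws fb that tI[of k] tI[of "Suc k"] in auto)
  have Ex: "\<bar>V (E k z) - V z - gradient V z \<bullet> (E k z - z)\<bar> \<le> a / 2 * norm (E k z - z)
      \<and> norm (E k z - z) \<le> W k" if "k < N" "V z \<le> c + 1" for k z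
  proof -
    have n: "norm (E k z - z) \<le> W k" using Eb[OF that] by (simp add: E_def)
    then have "norm (E k z - z) \<le> \<delta>0" using W(2)[of k] that \<delta> by linarith
    then show ?thesis using \<delta>0(2)[of z "E k z - z"] \<rho>(2)[of z] that n by simp
  qed
  have Evar: "V (E k z) \<le> V z + 1/4" if k: "k < N" "V z \<le> c + 1" for k z
  proof -
    have "\<bar>gradient V z \<bullet> (E k z - z)\<bar> \<le> G * norm (E k z - z)"
      using Cauchy_Schwarz_ineq2[of "gradient V z" "E k z - z"] G(2)[of z] k
        mult_right_mono[of "norm (gradient V z)" G "norm (E k z - z)"] by auto
    then have "V (E k z) - V z \<le> (G + a / 2) * norm (E k z - z)"
      using Ex[OF k, THEN conjunct1] unfolding distrib_right by linarith
    also have "\<dots> \<le> (G + a / 2) * \<delta>"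
      using Ex[OF k] W(2)[OF k(1)] G \<open>a > 0\<close> by (intro mult_left_mono) auto
    finally show ?thesis using \<delta>4 by linarith
  qed
  \<comment> \<open>The guiding margin yields a decrease of at least \<open>a * W k\<close>, and the
    remainder, with coefficient \<open>a / 2\<close>, gives back at most half of it.\<close>
  have Edrop: "V (E k z) \<le> V z - a / 2 * W k" if k: "k < N" "V z \<le> c + 1" "c - 1/2 \<le> V z" for k z
  proof -
    have i: "(\<lambda>r. f r z) integrable_on {t (Suc k)..t k}" "w integrable_on {t (Suc k)..t k}"
      using fs ws k tI[of k] tI[of "Suc k"] by auto
    have "a * W k = integral {t (Suc k)..t k} (\<lambda>r. a * w r)" by (simp add: W_def)
    also have "\<dots> \<le> integral {t (Suc k)..t k} (\<lambda>r. f r z \<bullet> gradient V z)"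
    proof (rule integral_le)
      show "(\<lambda>r. a * w r) integrable_on {t (Suc k)..t k}" using i(2) by (rule integrable_on_mult_right)
      show "(\<lambda>r. f r z \<bullet> gradient V z) integrable_on {t (Suc k)..t k}"
        using integrable_linear[OF i(1) bounded_linear_inner_left] by (simp add: o_def)
      fix r assume "r \<in> {t (Suc k)..t k}"
      then have "r \<in> {0..T}" using k tI[of k] tI[of "Suc k"] by auto
      then show "a * w r \<le> f r z \<bullet> gradient V z" using fg k by (simp add: inner_commute)
    qed
    also have "\<dots> = - (gradient V z \<bullet> (E k z - z))"
      using integral_component_eq[OF i(1), of "gradient V z"] by (simp add: E_def inner_commute)
    finally have "gradient V z \<bullet> (E k z - z) \<le> - (a * W k)" by linarith
    moreover have "a / 2 * norm (E k z - z) \<le> a / 2 * W k"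
      using Ex[OF k(1,2)] \<open>a > 0\<close> by (intro mult_left_mono) auto
    ultimately show ?thesis using Ex[OF k(1,2), THEN conjunct1]
        abs_ge_self[of "V (E k z) - V z - gradient V z \<bullet> (E k z - z)"]
      by (simp only: times_divide_eq_left)
  qed
  define Z where "Z k z = rec_nat z E k" for k z
  have Z: "Z 0 z = z" "Z (Suc k) z = E k (Z k z)" for k z by (auto simp: Z_def)
  \<comment> \<open>The slack is at most the total decrease over all steps, so that a start below
    \<open>c + \<eta>\<close> ends below \<open>c\<close>; the cap 1/4 keeps the start below
    \<open>c + 1\<close>.\<close>
  define \<eta> where "\<eta> = min (1/4) (a / 2 * (\<Sum>k<N. W k))"
  have "\<eta> > 0" unfolding \<eta>_def using \<open>a > 0\<close> W N by (auto intro!: mult_pos_pos sum_pos)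
  have \<eta>: "\<eta> \<le> 1/4" "\<eta> \<le> a / 2 * (\<Sum>k<N. W k)" by (auto simp: \<eta>_def)
  \<comment> \<open>Two regimes: from \<open>c - 1/2\<close> upwards every step lowers
    \<open>V\<close> by \<open>a / 2 * W k\<close>; from below \<open>c - 1/2\<close> no decrease is
    known, but one step climbs at most 1/4 and so stays below \<open>c - 1/4\<close>.\<close>
  have inv: "V (Z k z) \<le> max (c - 1/4) (c + \<eta> - a / 2 * (\<Sum>j<k. W j)) \<and> V (Z k z) \<le> c + 1"
    if "k \<le> N" "V z \<le> c + \<eta>" for k z
    using that(1)
  proof (induction k)
    case 0
    then show ?case using that \<eta> by (simp add: Z)
  next
    case (Suc k)
    then have k: "k < N" "V (Z k z) \<le> c + 1"
      and IH: "V (Z k z) \<le> max (c - 1/4) (c + \<eta> - a / 2 * (\<Sum>j<k. W j))" by auto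
    show ?case
    proof (cases "c - 1/2 \<le> V (Z k z)")
      case True
      have "0 < a / 2 * W k" using \<open>a > 0\<close> W k by simp
      then show ?thesis using Edrop[OF k True] IH k(2) by (auto simp: Z distrib_left)
    next
      case False
      then show ?thesis using Evar[OF k] by (auto simp: Z)
    qed
  qed
  have cE: "continuous_on ?S (E k)" if "k < N" for k
    unfolding E_def using that tI[of k] tI[of "Suc k"] tS[of k]
    by (intro continuous_intros fc) auto
  have cZ: "continuous_on {z. V z \<le> c + \<eta>} (Z k)" if "k \<le> N" for k
    using that
  proof (induction k)
    case 0
    then show ?case by (simp add: Z continuous_on_id)
  next
    case (Suc k)
    then have "continuous_on {z. V z \<le> c + \<eta>} (\<lambda>z. E k (Z k z))"
      by (intro continuous_on_compose2[OF cE[of k]]) (use inv[of k] in auto)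
    then show ?case by (simp add: Z)
  qed
  obtain z0 where z0: "V z0 \<le> c" "- Z N z0 = z0"
  proof (rule sublevel_fixed_point[OF V nz \<open>\<eta> > 0\<close>, where f = "\<lambda>z. - Z N z"])
    show "continuous_on {z. V z \<le> c + \<eta>} (\<lambda>z. - Z N z)"
      by (intro continuous_on_minus cZ) simp
    show "V (- Z N z) \<le> c" if "V z \<le> c + \<eta>" for z
      using inv[of N z] that \<eta> by (auto simp: even)
  qed auto
  have ZS: "V (Z k z0) \<le> c + 1" if "k \<le> N" for k
    using inv[OF that, of z0] z0(1) \<open>\<eta> > 0\<close> by auto
  \<comment> \<open>Cells are numbered backwards from \<open>T\<close>:
    \<open>\<kappa> s = k\<close> on the half-open cell from \<open>t (Suc k)\<close> (excluded) to
    \<open>t k\<close>, and \<open>\<kappa> 0 = N\<close>. The cap \<open>N\<close> and the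
    truncation by \<open>nat\<close> keep the index valid for every real \<open>s\<close>.\<close>
  define \<kappa> where "\<kappa> s = min N (nat \<lfloor>(T - s) * real N / T\<rfloor>)" for s
  define \<zeta> where "\<zeta> s = Z (\<kappa> s) z0" for s
  define v where "v s = f s (\<zeta> s)" for s
  \<comment> \<open>Anchored at the end value, so that \<open>x T = z0\<close> and \<open>x\<close>
    passes through the Euler points \<open>Z k z0\<close> at the grid times.\<close>
  define x where "x s = z0 - integral {s..T} v" for s
  have \<kappa>: "\<kappa> s \<le> N" for s by (simp add: \<kappa>_def)
  have \<zeta>S: "V (\<zeta> s) \<le> c + 1" for s using ZS \<kappa> by (simp add: \<zeta>_def)
  have \<kappa>I: "\<kappa> s = k" if "t (Suc k) < s" "s \<le> t k" "k < N" for s k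
  proof -
    have "real k \<le> (T - s) * real N / T" "(T - s) * real N / T < real k + 1"
      using that N \<open>T > 0\<close> by (auto simp: t_def field_simps)
    then have "\<lfloor>(T - s) * real N / T\<rfloor> = int k" by (intro floor_unique) auto
    then show ?thesis using that by (simp add: \<kappa>_def)
  qed
  have vm: "v \<in> borel_measurable (lebesgue_on {0..T})"
  proof -
    have "(\<lambda>s. f s (Z (min N i) z0)) \<in> borel_measurable (lebesgue_on {0..T})" for i
      by (intro fm ZS) simp
    moreover have "(\<lambda>s. nat \<lfloor>(T - s) * real N / T\<rfloor>) \<in> measurable (lebesgue_on {0..T}) (count_space UNIV)"
    proof -
      have [measurable]: "(\<lambda>s. s) \<in> borel_measurable (lebesgue_on {0..T})"
        by (rule continuous_imp_measurable_on_sets_lebesgue) (auto intro: continuous_on_id)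
      show ?thesis by measurable
    qed
    ultimately have "(\<lambda>s. f s (Z (min N (nat \<lfloor>(T - s) * real N / T\<rfloor>)) z0))
        \<in> borel_measurable (lebesgue_on {0..T})"
      by (rule measurable_compose_countable)
    then show ?thesis by (simp add: v_def[abs_def] \<zeta>_def \<kappa>_def)
  qed
  have vb: "norm (v s) \<le> w s" if "s \<in> {0..T}" for s
    using fb[OF that \<zeta>S] by (simp add: v_def)
  have vi: "v integrable_on {s..t}" if "0 \<le> s" "t \<le> T" for s t
  proof -
    have "v integrable_on {0..T}"
      by (rule measurable_bounded_by_integrable_imp_integrable[OF vm w(1) vb]) auto
    then show ?thesis using that by (rule_tac integrable_on_subinterval) auto
  qed
  have xd: "x t - x s = integral {s..t} v" if "0 \<le> s" "s \<le> t" "t \<le> T" for s t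
    using Henstock_Kurzweil_Integration.integral_combine[of s t T v] vi[of s T] that
    by (simp add: x_def algebra_simps)
  have xt: "x (t k) = Z k z0" if "k \<le> N" for k
    using that
  proof (induction k)
    case 0
    then show ?case by (simp add: x_def Z t0)
  next
    case (Suc k)
    have "x (t k) - x (t (Suc k)) = integral {t (Suc k)..t k} v"
      by (rule xd) (use tI[of k] tI[of "Suc k"] tS[of k] Suc in auto)
    also have "\<dots> = integral {t (Suc k)..t k} (\<lambda>r. f r (Z k z0))"
    proof (rule integral_spike[of "{t (Suc k)}"])
      fix r assume "r \<in> {t (Suc k)..t k} - {t (Suc k)}"
      then have "\<kappa> r = k" using Suc by (intro \<kappa>I) auto
      then show "f r (Z k z0) = v r" by (simp add: v_def \<zeta>_def)
    qed auto
    finally show ?case using Suc by (simp add: Z E_def algebra_simps)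
  qed
  have close: "norm (x s - \<zeta> s) \<le> \<gamma>" if s: "s \<in> {0..T}" for s
  proof (cases "s = 0")
    case True
    have "\<kappa> 0 = N" using \<open>T > 0\<close> by (simp add: \<kappa>_def)
    then have "x s = \<zeta> s" using xt[of N] True by (simp add: t0 \<zeta>_def)
    then show ?thesis using \<open>\<gamma> > 0\<close> by simp
  next
    case False
    define k where "k = nat \<lfloor>(T - s) * real N / T\<rfloor>"
    have pos: "0 \<le> (T - s) * real N / T" using s \<open>T > 0\<close> by simp
    then have k: "real k \<le> (T - s) * real N / T" "(T - s) * real N / T < real k + 1"
      unfolding k_def by linarith+
    have "(T - s) * real N / T < real N" using s False \<open>T > 0\<close> N by (simp add: field_simps)
    then have kN: "k < N" using k by linarith
    have st: "t (Suc k) < s" "s \<le> t k"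
      using k N \<open>T > 0\<close> by (auto simp: t_def field_simps)
    have tk: "0 \<le> t (Suc k)" "t k \<le> T" "t (Suc k) \<le> T"
      using tI[of k] tI[of "Suc k"] kN by auto
    have "\<zeta> s = x (t k)" using \<kappa>I[OF st kN] xt[of k] kN by (simp add: \<zeta>_def)
    then have "norm (x s - \<zeta> s) = norm (integral {s..t k} v)"
      using xd[of s "t k", symmetric] st s tk by (simp add: norm_minus_commute)
    also have "\<dots> \<le> integral {s..t k} w"
      by (rule integral_norm_bound_integral) (use vi ws vb s tk in auto)
    also have "\<dots> \<le> integral {t (Suc k)..t k} w"
    proof (rule integral_subset_le)
      show "\<forall>r\<in>{t (Suc k)..t k}. 0 \<le> w r"
        using w(2) tk by (metis atLeastAtMost_iff order_trans zero_le_one)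
    qed (use st s ws tk in auto)
    also have "\<dots> \<le> \<gamma>" using W(2)[OF kN] \<delta> by (simp add: W_def)
    finally show ?thesis .
  qed
  have "x 0 = - x T" using xt[of N] xt[of 0] z0(2) by (simp add: t0 Z) (metis minus_minus)
  then show ?thesis
    using that[of \<zeta> x] vm \<zeta>S close xd unfolding v_def by blast
qed

theorem theorem3:
  fixes T :: real
    and F :: "real \<Rightarrow> real^'n \<Rightarrow> (real^'n) set"
  assumes "T > 0"
    and "caratheodory_map {0..T} F"
    and "\<exists>V :: real^'n \<Rightarrow> real.
           (\<forall>x. V (- x) = V x) \<and> coercive V \<and> weakly_positively_guiding {0..T} F V"
  shows "\<exists>x :: real \<Rightarrow> real^'n.
           absolutely_continuous_fun 0 T x \<and>
           (AE t in lebesgue_on {0..T}.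
              \<exists>v\<in>F t (x t). (x has_vector_derivative v) (at t within {0..T})) \<and>
           x 0 = - x T"
proof -
  note F = assms(2)
  obtain V :: "real^'n \<Rightarrow> real" where even: "\<And>x. V (- x) = V x" and "coercive V"
    and wpg: "weakly_positively_guiding {0..T} F V" using assms(3) by blast
  have V: "C1_potential V" "coercive V"
    using wpg \<open>coercive V\<close> by (auto simp: weakly_positively_guiding_def)
  note cV = C1_potential_continuous[OF V(1)]
  obtain R1 where R1: "\<And>x. R1 \<le> norm x \<Longrightarrow> gradient V x \<noteq> 0"
    using wpg by (auto simp: weakly_positively_guiding_def nonsingular_potential_def)
  obtain R2 where R2: "\<And>x t. R2 \<le> norm x \<Longrightarrow> t \<in> {0..T} \<Longrightarrow> \<exists>y\<in>F t x. 0 \<le> gradient V x \<bullet> y"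
    using wpg unfolding weakly_positively_guiding_def by blast
  have "bounded (V ` cball 0 (max R1 R2))" by (intro compact_imp_bounded compact_continuous_image cV) auto
  then obtain c0 where "\<forall>y\<in>V ` cball 0 (max R1 R2). norm y \<le> c0" by (auto simp: bounded_iff)
  then have c0: "V x \<le> c0" if "norm x \<le> max R1 R2" for x
    using that by (auto simp: image_iff Ball_def dest!: spec[of _ "V x"])
  \<comment> \<open>Now \<open>c - 1 = c0\<close> bounds \<open>V\<close> on the ball of radius
    \<open>max R1 R2\<close>, so \<open>V x > c - 1\<close> forces \<open>x\<close> outside both
    exceptional balls.\<close>
  define c where "c = c0 + 1"
  have far: "max R1 R2 \<le> norm x" if "c - 1 < V x" for x
    using c0[of x] that by (cases "norm x \<le> max R1 R2") (auto simp: c_def)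
  obtain \<mu> where \<mu>0: "integrable (lebesgue_on {0..T}) \<mu>"
    "\<And>t x. t \<in> {0..T} \<Longrightarrow> (SUP y\<in>F t x. norm y) \<le> \<mu> t * (1 + norm x)"
    using F by (auto simp: caratheodory_map_def)
  have \<mu>i: "\<mu> integrable_on {0..T}" using \<mu>0(1) by (rule integrable_on_lebesgue_on) simp
  have \<mu>b: "norm y \<le> \<mu> t * (1 + norm x)" if "t \<in> {0..T}" "y \<in> F t x" for t x y
  proof -
    have "compact (F t x)" using F that by (auto simp: caratheodory_map_def)
    \<comment> \<open>Compactness of the value makes the supremum a genuine upper bound, so the
      growth condition can be read elementwise.\<close>
    then have "bdd_above (norm ` F t x)"
      by (intro bounded_imp_bdd_above compact_imp_bounded compact_continuous_image continuous_intros)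
    then have "norm y \<le> (SUP y\<in>F t x. norm y)" using that by (intro cSUP_upper)
    then show ?thesis using \<mu>0(2)[OF that(1), of x] by linarith
  qed
  \<comment> \<open>The sign of \<open>\<mu>\<close> is forced by the growth condition at the state
    0, where some velocity exists.\<close>
  have \<mu>p: "0 \<le> \<mu> t" if "t \<in> {0..T}" for t
  proof -
    have "F t 0 \<noteq> {}" using F that by (simp add: caratheodory_map_def)
    then obtain y where "y \<in> F t 0" by blast
    then show ?thesis using \<mu>b[OF that, of y 0] norm_ge_zero[of y] by (simp del: norm_ge_zero)
  qed
  have nz: "gradient V x \<noteq> 0" if "c - 1 < V x" for x using far[OF that] by (intro R1) simp
  have guide: "\<exists>y\<in>F t x. 0 \<le> gradient V x \<bullet> y" if "t \<in> {0..T}" "c - 1 < V x" for t x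
    using far[OF that(2)] that(1) by (intro R2) auto
  obtain C where C: "C \<ge> 1" and approx:
    "\<And>\<epsilon>. \<epsilon> > 0 \<Longrightarrow> \<exists>f a. a > 0 \<and>
      (\<forall>z. (\<lambda>t. f t z) \<in> borel_measurable (lebesgue_on {0..T})) \<and>
      (\<forall>t\<in>{0..T}. \<forall>z. V z \<le> c + 1 \<longrightarrow> norm (f t z) \<le> C * (1 + \<mu> t)) \<and>
      (\<forall>s t. 0 \<le> s \<longrightarrow> t \<le> T \<longrightarrow> continuous_on {z. V z \<le> c + 1} (\<lambda>z. integral {s..t} (\<lambda>r. f r z))) \<and>
      (\<forall>t\<in>{0..T}. \<forall>z. c - 1/2 \<le> V z \<longrightarrow> V z \<le> c + 1 \<longrightarrow> a * (C * (1 + \<mu> t)) \<le> gradient V z \<bullet> f t z) \<and>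
      (\<forall>t\<in>{0..T}. \<forall>z. V z \<le> c + 1 \<longrightarrow>
        (\<exists>b \<in> convex hull (\<Union>y\<in>cball z \<epsilon>. F t y). norm (f t z - b) \<le> \<epsilon> * (C * (1 + \<mu> t))))"
    by (rule guided_continuous_approximation[OF F \<mu>i \<mu>p \<mu>b V nz guide]) blast+
  define w where "w t = C * (1 + \<mu> t)" for t
  have w1: "1 \<le> w t" if "t \<in> {0..T}" for t
    using mult_mono[OF C, of 1 "1 + \<mu> t"] \<mu>p[OF that] C by (simp add: w_def)
  have wi: "w integrable_on {0..T}"
    unfolding w_def using \<mu>i by (intro integrable_on_mult_right integrable_add) auto
  obtain \<rho> where \<rho>: "\<And>x. V x \<le> c + 1 \<Longrightarrow> norm x \<le> \<rho>"
    using coercive_sublevel_bounded[OF V(2)] by blast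
  define e where "e n = 1 / (real n + 1)" for n
  have e_pos: "0 < e n" and e1: "e n \<le> 1" for n by (simp_all add: e_def)
  define P where "P n x v \<longleftrightarrow> v \<in> borel_measurable (lebesgue_on {0..T}) \<and>
      (\<forall>t\<in>{0..T}. norm (v t) \<le> w t) \<and>
      (\<forall>s t. 0 \<le> s \<longrightarrow> s \<le> t \<longrightarrow> t \<le> T \<longrightarrow> x t - x s = integral {s..t} v) \<and>
      (\<forall>t\<in>{0..T}. norm (x t) \<le> \<rho> + 1) \<and> x 0 = - x T \<and>
      (\<forall>t\<in>{0..T}. \<exists>b \<in> convex hull (\<Union>y\<in>cball (x t) (e n). F t y). norm (v t - b) \<le> e n * w t)"
    for n and x v :: "real \<Rightarrow> real^'n"
  have "\<exists>x v. P n x v" for n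
  proof -
    define \<epsilon> where "\<epsilon> = e n / 2"
    have \<epsilon>: "\<epsilon> > 0" "\<epsilon> \<le> e n" "\<epsilon> \<le> 1" using e_pos[of n] e1[of n] by (auto simp: \<epsilon>_def)
    obtain f a where a: "a > 0" and fm: "\<And>z. (\<lambda>t. f t z) \<in> borel_measurable (lebesgue_on {0..T})"
      and fb: "\<And>t z. t \<in> {0..T} \<Longrightarrow> V z \<le> c + 1 \<Longrightarrow> norm (f t z) \<le> w t"
      and fc: "\<And>s t. 0 \<le> s \<Longrightarrow> t \<le> T \<Longrightarrow> continuous_on {z. V z \<le> c + 1} (\<lambda>z. integral {s..t} (\<lambda>r. f r z))"
      and fg: "\<And>t z. t \<in> {0..T} \<Longrightarrow> c - 1/2 \<le> V z \<Longrightarrow> V z \<le> c + 1 \<Longrightarrow> a * w t \<le> gradient V z \<bullet> f t z"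
      and fh: "\<And>t z. t \<in> {0..T} \<Longrightarrow> V z \<le> c + 1 \<Longrightarrow>
        \<exists>b \<in> convex hull (\<Union>y\<in>cball z \<epsilon>. F t y). norm (f t z - b) \<le> \<epsilon> * w t"
      using approx[OF \<epsilon>(1)] unfolding w_def[symmetric] by (elim exE conjE) (rule that; blast)
    have nz': "gradient V x \<noteq> 0" if "c \<le> V x" for x by (rule nz) (use that in simp)
    obtain x \<zeta> where vm: "(\<lambda>t. f t (\<zeta> t)) \<in> borel_measurable (lebesgue_on {0..T})"
      and \<zeta>S: "\<And>t. t \<in> {0..T} \<Longrightarrow> V (\<zeta> t) \<le> c + 1"
      and close: "\<And>t. t \<in> {0..T} \<Longrightarrow> norm (x t - \<zeta> t) \<le> \<epsilon>"
      and xd: "\<And>s t. 0 \<le> s \<Longrightarrow> s \<le> t \<Longrightarrow> t \<le> T \<Longrightarrow> x t - x s = integral {s..t} (\<lambda>t. f t (\<zeta> t))"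
      and anti: "x 0 = - x T"
      by (rule euler_antiperiodic[OF \<open>T > 0\<close> V even nz' wi w1 fm fb fc a fg \<epsilon>(1)]) blast+
    have "norm (x t) \<le> \<rho> + 1" if "t \<in> {0..T}" for t
      using close[OF that] \<rho>[OF \<zeta>S[OF that]] \<epsilon>(3) norm_triangle_sub[of "x t" "\<zeta> t"] by linarith
    moreover have "\<exists>b \<in> convex hull (\<Union>y\<in>cball (x t) (e n). F t y). norm (f t (\<zeta> t) - b) \<le> e n * w t"
      if t: "t \<in> {0..T}" for t
    proof -
      obtain b where b: "b \<in> convex hull (\<Union>y\<in>cball (\<zeta> t) \<epsilon>. F t y)" "norm (f t (\<zeta> t) - b) \<le> \<epsilon> * w t"
        using fh[OF t \<zeta>S[OF t]] by blast
      have "cball (\<zeta> t) \<epsilon> \<subseteq> cball (x t) (e n)"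
      proof
        fix y assume "y \<in> cball (\<zeta> t) \<epsilon>"
        then show "y \<in> cball (x t) (e n)"
          using close[OF t] dist_triangle[of "x t" y "\<zeta> t"] by (simp add: dist_norm \<epsilon>_def)
      qed
      then have "convex hull (\<Union>y\<in>cball (\<zeta> t) \<epsilon>. F t y) \<subseteq> convex hull (\<Union>y\<in>cball (x t) (e n). F t y)"
        by (intro hull_mono UN_mono) auto
      moreover have "\<epsilon> * w t \<le> e n * w t" using \<epsilon>(2) w1[OF t] by (intro mult_right_mono) auto
      ultimately show ?thesis using b by (meson order_trans subsetD)
    qed
    ultimately have "P n x (\<lambda>t. f t (\<zeta> t))"
      unfolding P_def using vm fb \<zeta>S xd anti by blast
    then show ?thesis by blast
  qed
  then obtain x v where xv: "\<And>n. P n (x n) (v n)" by metis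
  have e0: "e \<longlonglongrightarrow> 0"
    unfolding e_def using LIMSEQ_inverse_real_of_nat by (simp add: inverse_eq_divide add.commute)
  have w0: "0 < w t" if "t \<in> {0..T}" for t using w1[OF that] by linarith
  note P = xv[unfolded P_def]
  show ?thesis
  proof (rule caratheodory_limit_solution[OF assms(1) F wi w0 _ _ _ _ _ e0])
    show "v n \<in> borel_measurable (lebesgue_on {0..T})" for n using P by blast
    show "norm (v n t) \<le> w t" if "t \<in> {0..T}" for n t using P that by blast
    show "x n t - x n s = integral {s..t} (v n)" if "0 \<le> s" "s \<le> t" "t \<le> T" for n s t
      using P that by blast
    show "norm (x n t) \<le> \<rho> + 1" if "t \<in> {0..T}" for n t using P that by blast
    show "x n 0 = - x n T" for n using P by blast
    show "\<exists>b \<in> convex hull (\<Union>y\<in>cball (x n t) (e n). F t y). norm (v n t - b) \<le> e n * w t"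
      if "t \<in> {0..T}" for n t using P that by blast
  qed
qed

end
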